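(* The critical exponent of the infinite binary word $u=f(g(h^\omega(0)))$ is $2+\sqrt{2}/2$.
   Context: Morphisms: $f:\{0,1,2\}^*\to\{0,1\}^*$, $f(0)=0$, $f(1)=01$, $f(2)=011$; $g,h:\{0,1,2\}^*\to\{0,1,2\}^*$, $g(0)=011$, $g(1)=0121$, $g(2)=012121$, $h(0)=01$, $h(1)=02$, $h(2)=022$. $h^\omega(0)=\lim_n h^n(0)$ is the infinite fixed point of $h$ starting with $0$. A finite word $z=z_1\cdots z_m$ has period $p$ if $z_j=z_{j+p}$ for $1\le j\le m-p$, and then $m/p$ is an exponent of $z$. A word contains an $\alpha$-power if it has a nonempty factor with an exponent $\ge\alpha$; its critical exponent is the supremum of all rational $\alpha$ such that it contains an $\alpha$-power. *)

theory Defs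
  imports "HOL-Library.Omega_Words_Fun" "HOL-Library.Extended_Real"
begin

text \<open>
  Finite words are lists, and infinite words are functions on \<^typ>\<open>nat\<close> (the type
  \<^typ>\<open>'a word\<close>), so all positions are counted from 0. A sequence of finite words tends to an
  infinite word if every position is eventually present and eventually carries the right letter.
\<close>

definition word_tendsto :: "(nat \<Rightarrow> 'a list) \<Rightarrow> 'a word \<Rightarrow> bool" where
  "word_tendsto W w \<longleftrightarrow> (\<forall>k. \<forall>\<^sub>F n in sequentially. k < length (W n) \<and> W n ! k = w k)"

definition word_lim :: "(nat \<Rightarrow> 'a list) \<Rightarrow> 'a word" where
  "word_lim W = (THE w. word_tendsto W w)"

lemma word_tendsto_unique:
  assumes "word_tendsto W v" "word_tendsto W w"
  shows "v = w"
proof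
  fix k
  have "\<forall>\<^sub>F n in sequentially. v k = w k"
    using assms[unfolded word_tendsto_def, THEN spec[of _ k]] by eventually_elim simp
  then show "v k = w k" by simp
qed

lemma word_lim_eq: "word_tendsto W w \<Longrightarrow> word_lim W = w"
  unfolding word_lim_def by (blast intro: the_equality word_tendsto_unique)

lemma word_tendsto_word_lim:
  assumes chain: "\<And>n. \<exists>v. W (Suc n) = W n @ v"
    and long: "\<And>k. \<exists>n. k < length (W n)"
  shows "word_tendsto W (word_lim W)"
proof -
  have ext: "\<exists>v. W n = W m @ v" if "m \<le> n" for m n
    using that
  proof (induction n rule: dec_induct)
    case base
    show ?case by simp
  next
    case (step n)
    then show ?case using chain[of n] by force
  qed
  define N where "N k = (SOME n. k < length (W n))" for k
  have N: "k < length (W (N k))" for k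
    unfolding N_def using long by (rule someI_ex)
  have "word_tendsto W (\<lambda>k. W (N k) ! k)"
    unfolding word_tendsto_def
  proof
    fix k
    show "\<forall>\<^sub>F n in sequentially. k < length (W n) \<and> W n ! k = W (N k) ! k"
      using eventually_ge_at_top[of "N k"]
    proof eventually_elim
      case (elim n)
      then show ?case using ext[OF elim] N[of k] by (auto simp: nth_append)
    qed
  qed
  then show ?thesis using word_lim_eq by metis
qed

text \<open>The morphism of free monoids determined by the images of the letters.\<close>

definition morph :: "('a \<Rightarrow> 'b list) \<Rightarrow> 'a list \<Rightarrow> 'b list" where
  "morph \<phi> w = concat (map \<phi> w)"

definition morph_inf :: "('a list \<Rightarrow> 'b list) \<Rightarrow> 'a word \<Rightarrow> 'b word" where
  "morph_inf m w = word_lim (\<lambda>n. m (prefix n w))"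

definition omega_iterate :: "('a list \<Rightarrow> 'a list) \<Rightarrow> 'a \<Rightarrow> 'a word" where
  "omega_iterate m a = word_lim (\<lambda>n. (m ^^ n) [a])"

lemma morph_Nil [simp]: "morph \<phi> [] = []"
  and morph_Cons [simp]: "morph \<phi> (x # xs) = \<phi> x @ morph \<phi> xs"
  and morph_append [simp]: "morph \<phi> (xs @ ys) = morph \<phi> xs @ morph \<phi> ys"
  by (simp_all add: morph_def)

lemma length_morph_ge:
  assumes "\<And>x. \<phi> x \<noteq> []"
  shows "length xs \<le> length (morph \<phi> xs)"
proof (induction xs)
  case (Cons x xs)
  then show ?case using assms[of x] by (cases "\<phi> x") auto
qed simp

lemma word_tendsto_morph_inf:
  assumes "\<And>x. \<phi> x \<noteq> []"
  shows "word_tendsto (\<lambda>n. morph \<phi> (prefix n w)) (morph_inf (morph \<phi>) w)"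
  unfolding morph_inf_def
proof (rule word_tendsto_word_lim)
  show "\<exists>v. morph \<phi> (prefix (Suc n) w) = morph \<phi> (prefix n w) @ v" for n
    by (auto simp: subsequence_def)
  show "\<exists>n. k < length (morph \<phi> (prefix n w))" for k
    using length_morph_ge[of \<phi> "prefix (Suc k) w"] assms by (auto intro!: exI[of _ "Suc k"])
qed

lemma word_tendsto_omega_iterate:
  assumes nonerasing: "\<And>x. \<phi> x \<noteq> []" and start: "\<phi> a = a # v" "v \<noteq> []"
  shows "word_tendsto (\<lambda>n. (morph \<phi> ^^ n) [a]) (omega_iterate (morph \<phi>) a)"
  unfolding omega_iterate_def
proof (rule word_tendsto_word_lim)
  have app: "(morph \<phi> ^^ n) (xs @ ys) = (morph \<phi> ^^ n) xs @ (morph \<phi> ^^ n) ys" for n xs ys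
    by (induction n) auto
  have len: "length xs \<le> length ((morph \<phi> ^^ n) xs)" for n xs
  proof (induction n)
    case (Suc n)
    then show ?case
      using length_morph_ge[of \<phi> "(morph \<phi> ^^ n) xs", OF nonerasing] by simp
  qed simp
  have step: "(morph \<phi> ^^ Suc n) [a] = (morph \<phi> ^^ n) [a] @ (morph \<phi> ^^ n) v" for n
    using app[of n "[a]" v] start by (simp del: funpow.simps add: funpow_Suc_right)
  show "\<exists>v. (morph \<phi> ^^ Suc n) [a] = (morph \<phi> ^^ n) [a] @ v" for n
    using step by blast
  have "n < length ((morph \<phi> ^^ n) [a])" for n
  proof (induction n)
    case (Suc n)
    have "0 < length ((morph \<phi> ^^ n) v)" using len[of v n] start by (cases v) auto
    then show ?case using Suc unfolding step length_append by linarith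
  qed simp
  then show "\<exists>n. k < length ((morph \<phi> ^^ n) [a])" for k by blast
qed

datatype binary = B0 | B1

datatype ternary = T0 | T1 | T2

fun f_letter :: "ternary \<Rightarrow> binary list" where
  "f_letter T0 = [B0]"
| "f_letter T1 = [B0, B1]"
| "f_letter T2 = [B0, B1, B1]"

fun g_letter :: "ternary \<Rightarrow> ternary list" where
  "g_letter T0 = [T0, T1, T1]"
| "g_letter T1 = [T0, T1, T2, T1]"
| "g_letter T2 = [T0, T1, T2, T1, T2, T1]"

fun h_letter :: "ternary \<Rightarrow> ternary list" where
  "h_letter T0 = [T0, T1]"
| "h_letter T1 = [T0, T2]"
| "h_letter T2 = [T0, T2, T2]"

definition morph_f :: "ternary list \<Rightarrow> binary list" where
  "morph_f = morph f_letter"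

definition morph_g :: "ternary list \<Rightarrow> ternary list" where
  "morph_g = morph g_letter"

definition morph_h :: "ternary list \<Rightarrow> ternary list" where
  "morph_h = morph h_letter"

text \<open>All limits involved exist, so no value of \<^const>\<open>word_lim\<close> below is arbitrary.\<close>

lemma morph_f_inf: "word_tendsto (\<lambda>n. morph_f (prefix n w)) (morph_inf morph_f w)"
  unfolding morph_f_def
proof (rule word_tendsto_morph_inf)
  show "f_letter x \<noteq> []" for x by (cases x) auto
qed

lemma morph_g_inf: "word_tendsto (\<lambda>n. morph_g (prefix n w)) (morph_inf morph_g w)"
  unfolding morph_g_def
proof (rule word_tendsto_morph_inf)
  show "g_letter x \<noteq> []" for x by (cases x) auto
qed

lemma omega_iterate_h: "word_tendsto (\<lambda>n. (morph_h ^^ n) [T0]) (omega_iterate morph_h T0)"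
  unfolding morph_h_def
proof (rule word_tendsto_omega_iterate)
  show "h_letter x \<noteq> []" for x by (cases x) auto
qed auto

definition has_period :: "'a list \<Rightarrow> nat \<Rightarrow> bool" where
  "has_period z p \<longleftrightarrow> 0 < p \<and> (\<forall>j. j + p < length z \<longrightarrow> z ! j = z ! (j + p))"

definition has_exponent :: "'a list \<Rightarrow> rat \<Rightarrow> bool" where
  "has_exponent z e \<longleftrightarrow> (\<exists>p. has_period z p \<and> e = of_nat (length z) / of_nat p)"

definition factor :: "'a list \<Rightarrow> 'a word \<Rightarrow> bool" where
  "factor z w \<longleftrightarrow> (\<exists>i j. z = w [i \<rightarrow> j])"

definition contains_power :: "'a word \<Rightarrow> rat \<Rightarrow> bool" where
  "contains_power w \<alpha> \<longleftrightarrow> (\<exists>z e. factor z w \<and> z \<noteq> [] \<and> has_exponent z e \<and> \<alpha> \<le> e)"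

text \<open>
  The supremum is taken in the extended reals, since a word may contain arbitrarily high powers
  (on \<^typ>\<open>real\<close>, \<^const>\<open>Sup\<close> of an unbounded set is unspecified).
\<close>

definition critical_exponent :: "'a word \<Rightarrow> ereal" where
  "critical_exponent w = Sup {ereal (of_rat \<alpha>) | \<alpha>. contains_power w \<alpha>}"

end

theory Submission
  imports Defs
begin

text \<open>
  All three morphisms are marked: every block starts with the letter 0, which occurs nowhere else in
  it. Hence a maximal repetition with period \<open>p\<close> whose repeated part contains a 0 is the image
  of a unique maximal repetition of the preimage, whose period is
  not longer (and is shorter in the case of \<open>h\<close>), and its length is
  determined by the preimage and by the letters at the two mismatches. As \<open>h\<^sup>\<omega>(0)\<close> is fixed by \<open>h\<close>,
  every repetition of \<open>u\<close> descends through \<open>f\<close>, \<open>g\<close> and some power \<open>h\<^sup>n\<close> to one whose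
  repeated part contains no 0, and there are only a few kinds of those. The lengths
  \<open>A\<^sub>n = \<bar>f(g(h\<^sup>n(0)))\<bar>\<close> are 5, 13, 31, \<dots> with \<open>A\<^sub>n\<^sub>+\<^sub>2 = 2 A\<^sub>n\<^sub>+\<^sub>1 + A\<^sub>n\<close>, and all the other lengths are affine
  in \<open>A\<^sub>n\<close> and \<open>A\<^sub>n\<^sub>+\<^sub>1\<close>. The repetitions descending to a single 0 (period 1, nothing
  repeated) are extremal; they have period \<open>A\<^sub>n\<close> and excess \<open>(A\<^sub>n + A\<^sub>n\<^sub>+\<^sub>1) / 2 - 1\<close>; the
  ratio tends to \<open>(1 + (1 + \<surd>2)) / 2 = 1 + \<surd>2 / 2\<close>.
\<close>

abbreviation weight :: "('a \<Rightarrow> real) \<Rightarrow> 'a list \<Rightarrow> real" where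
  "weight \<alpha> w \<equiv> sum_list (map \<alpha> w)"

lemma weight_morph: "weight \<alpha> (morph \<phi> w) = weight (\<lambda>a. weight \<alpha> (\<phi> a)) w"
  by (induction w) auto

lemma subsequence_join: "a \<le> b \<Longrightarrow> b \<le> c \<Longrightarrow> w [a \<rightarrow> b] @ w [b \<rightarrow> c] = w [a \<rightarrow> c]"
  unfolding subsequence_def by (metis le_Suc_ex map_append upt_add_eq_append)

lemma subsequence_eq_iff:
  "w [i \<rightarrow> i + n] = v [j \<rightarrow> j + n] \<longleftrightarrow> (\<forall>k<n. w (i + k) = v (j + k))"
  by (auto simp: list_eq_iff_nth_eq)

section \<open>Maximal repeats\<close>

text \<open>The exponent of the repetition occupying the positions \<open>i, \<dots>, i + p + l - 1\<close>
  is \<open>1 + l / p\<close>. A repeat at position 0 counts as maximal on the left.\<close>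

definition maximal_repeat :: "'a word \<Rightarrow> nat \<Rightarrow> nat \<Rightarrow> nat \<Rightarrow> bool" where
  "maximal_repeat w i p l \<longleftrightarrow> 0 < p \<and> w [i \<rightarrow> i + l] = w [i + p \<rightarrow> i + p + l]
     \<and> w (i + l) \<noteq> w (i + p + l) \<and> (0 < i \<longrightarrow> w (i - 1) \<noteq> w (i + p - 1))"

lemma maximal_repeatD:
  assumes "maximal_repeat w i p l"
  shows "0 < p" "\<And>k. k < l \<Longrightarrow> w (i + k) = w (i + p + k)" "w (i + l) \<noteq> w (i + p + l)"
    "0 < i \<Longrightarrow> w (i - 1) \<noteq> w (i + p - 1)"
  using assms unfolding maximal_repeat_def subsequence_eq_iff by blast+

lemma maximal_repeat_match:
  assumes "maximal_repeat w i p l" "i \<le> k" "k < i + l"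
  shows "w k = w (k + p)"
  using maximal_repeatD(2)[OF assms(1), of "k - i"] assms(2,3) by (simp add: algebra_simps)

text \<open>If \<open>i < i'\<close>, then \<open>i' - 1\<close> lies in the repeated part of the
  first repeat, against left maximality of the second; the right ends are compared in the same way.
  The upper bounds on \<open>c\<close> are weak, so touching and even empty repeats are
  covered.\<close>

lemma maximal_repeat_unique:
  assumes "maximal_repeat w i p l" "maximal_repeat w i' p l'"
    and "i \<le> c" "c \<le> i + l" "i' \<le> c" "c \<le> i' + l'"
  shows "i = i'" "l = l'"
proof -
  have no_less: "\<not> i < i'" if "maximal_repeat w i p l" "maximal_repeat w i' p l'"
    "c \<le> i + l" "i' \<le> c" for i l i' l'
  proof
    assume "i < i'"
    then show False
      using maximal_repeat_match[OF that(1), of "i' - 1"] maximal_repeatD(4)[OF that(2)] that(3,4)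
      by fastforce
  qed
  show i: "i = i'"
    using no_less[OF assms(1,2,4,5)] no_less[OF assms(2,1,6,3)] by simp
  have no_less': "\<not> l < l'" if "maximal_repeat w i p l" "maximal_repeat w i p l'" for l l'
    using maximal_repeatD(3)[OF that(1)] maximal_repeat_match[OF that(2), of "i + l"]
    by (auto simp: algebra_simps)
  show "l = l'"
    using no_less'[of l l'] no_less'[of l' l] assms(1,2) i by auto
qed

text \<open>Extend to the left until a mismatch or position 0, and to the right to the first
  mismatch, which the last hypothesis provides. With \<open>i = j\<close> the extension starts from
  an empty repeat.\<close>

lemma ex_maximal_repeat:
  assumes "0 < p" and match: "\<And>k. i \<le> k \<Longrightarrow> k < j \<Longrightarrow> w k = w (k + p)" and "i \<le> j"
    and "\<exists>k\<ge>i. w k \<noteq> w (k + p)"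
  obtains i' l where "maximal_repeat w i' p l" "i' \<le> i" "j \<le> i' + l"
proof -
  define P where "P a \<longleftrightarrow> a \<le> i \<and> (\<forall>k. a \<le> k \<longrightarrow> k < i \<longrightarrow> w k = w (k + p))" for a
  define a where "a = Least P"
  define Q where "Q b \<longleftrightarrow> i \<le> b \<and> w b \<noteq> w (b + p)" for b
  define b where "b = Least Q"
  have a: "P a" unfolding a_def by (rule LeastI[of _ i]) (simp add: P_def)
  obtain k where "Q k" using assms(4) unfolding Q_def by blast
  then have b: "Q b" unfolding b_def by (rule LeastI)
  have below_b: "w k = w (k + p)" if "i \<le> k" "k < b" for k
    using not_less_Least[of k Q] that unfolding b_def Q_def by blast
  have jb: "j \<le> b"
    using b match[of b] unfolding Q_def by force
  have "w (a - 1) \<noteq> w (a + p - 1)" if "0 < a"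
  proof
    assume eq: "w (a - 1) = w (a + p - 1)"
    have "P (a - 1)"
      unfolding P_def
    proof (intro conjI allI impI)
      fix k assume "a - 1 \<le> k" "k < i"
      then consider "k = a - 1" | "a \<le> k" by linarith
      then show "w k = w (k + p)"
        using eq a \<open>0 < a\<close> \<open>k < i\<close> unfolding P_def by cases auto
    qed (use a in \<open>auto simp: P_def\<close>)
    then show False using not_less_Least[of "a - 1" P] that unfolding a_def by simp
  qed
  moreover have "w [a \<rightarrow> a + (b - a)] = w [a + p \<rightarrow> a + p + (b - a)]"
    unfolding subsequence_eq_iff
  proof (intro allI impI)
    fix k assume "k < b - a"
    then have "w (a + k) = w (a + k + p)"
      using a below_b[of "a + k"] unfolding P_def by (cases "a + k < i") auto
    then show "w (a + k) = w (a + p + k)" by (simp add: algebra_simps)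
  qed
  ultimately have "maximal_repeat w a p (b - a)"
    using a b assms(1) unfolding maximal_repeat_def P_def Q_def by (auto simp: algebra_simps)
  then show thesis
    using that a b jb unfolding P_def Q_def by force
qed

text \<open>The length of the repeat obtained by lifting \<open>(i, p, l)\<close> through a morphism: \<open>\<alpha>\<close> gives
  the lengths of the images of letters, \<open>R\<close> and \<open>L\<close> the lengths by which the repeat gets extended
  to the right and to the left, which depend only on the two mismatching letters.\<close>

definition cost :: "('a \<Rightarrow> real) \<Rightarrow> ('a \<Rightarrow> 'a \<Rightarrow> real) \<Rightarrow> ('a \<Rightarrow> 'a \<Rightarrow> real) \<Rightarrow> 'a word \<Rightarrow> nat \<Rightarrow> nat \<Rightarrow> nat \<Rightarrow> real"
  where
  "cost \<alpha> R L w i p l = weight \<alpha> (w [i \<rightarrow> i + l]) + R (w (i + l)) (w (i + p + l))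
     + (if i = 0 then 0 else L (w (i - 1)) (w (i + p - 1)))"

section \<open>Images under marked morphisms\<close>

text \<open>The image of every letter starts with \<open>z\<close> and contains no other \<open>z\<close>, so the occurrences of
  \<open>z\<close> in \<open>X = \<phi>(Y)\<close> are exactly the block boundaries. The longest common prefix of \<open>\<phi> c z\<close> and
  \<open>\<phi> d z\<close> has length \<open>\<rho> c d\<close>, the longest common suffix of \<open>\<phi> c\<close> and \<open>\<phi> d\<close> has length \<open>\<sigma> c d\<close>.\<close>

locale marked_image =
  fixes \<phi> :: "'a \<Rightarrow> 'b list" and Y :: "'a word" and X :: "'b word" and z :: 'b
    and \<rho> \<sigma> :: "'a \<Rightarrow> 'a \<Rightarrow> nat"
  assumes image: "prefix (length (morph \<phi> (prefix n Y))) X = morph \<phi> (prefix n Y)"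
    and nonempty: "\<phi> a \<noteq> []"
    and marked: "k < length (\<phi> a) \<Longrightarrow> \<phi> a ! k = z \<longleftrightarrow> k = 0"
    and right_le: "c \<noteq> d \<Longrightarrow> \<rho> c d \<le> length (\<phi> c) \<and> \<rho> c d \<le> length (\<phi> d)"
    and right_eq: "c \<noteq> d \<Longrightarrow> take (\<rho> c d) (\<phi> c) = take (\<rho> c d) (\<phi> d)"
    and right_neq: "c \<noteq> d \<Longrightarrow> (\<phi> c @ [z]) ! \<rho> c d \<noteq> (\<phi> d @ [z]) ! \<rho> c d"
    and left_le: "c \<noteq> d \<Longrightarrow> \<sigma> c d < length (\<phi> c) \<and> \<sigma> c d < length (\<phi> d)"
    and left_eq: "c \<noteq> d \<Longrightarrow> drop (length (\<phi> c) - \<sigma> c d) (\<phi> c) = drop (length (\<phi> d) - \<sigma> c d) (\<phi> d)"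
    and left_neq: "c \<noteq> d \<Longrightarrow> \<phi> c ! (length (\<phi> c) - \<sigma> c d - 1) \<noteq> \<phi> d ! (length (\<phi> d) - \<sigma> c d - 1)"
begin

definition pos :: "nat \<Rightarrow> nat" where
  "pos n = length (morph \<phi> (prefix n Y))"

lemma pos_0 [simp]: "pos 0 = 0"
  by (simp add: pos_def subsequence_def)

lemma prefix_split: "a \<le> b \<Longrightarrow> prefix b Y = prefix a Y @ Y [a \<rightarrow> b]"
  using subsequence_join[of 0 a b Y] by simp

lemma pos_add: "a \<le> b \<Longrightarrow> pos b = pos a + length (morph \<phi> (Y [a \<rightarrow> b]))"
  unfolding pos_def by (simp add: prefix_split)

lemma pos_mono: "a \<le> b \<Longrightarrow> pos a \<le> pos b"
  by (simp add: pos_add)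

lemma pos_Suc: "pos (Suc a) = pos a + length (\<phi> (Y a))"
  by (subst pos_add[of a]) auto

lemma strict_mono_pos: "strict_mono pos"
  using nonempty by (intro strict_mono_Suc_iff[THEN iffD2]) (simp add: pos_Suc)

lemma pos_segment: "a \<le> b \<Longrightarrow> X [pos a \<rightarrow> pos b] = morph \<phi> (Y [a \<rightarrow> b])"
proof -
  assume ab: "a \<le> b"
  have "prefix (pos b) X = prefix (pos a) X @ morph \<phi> (Y [a \<rightarrow> b])"
    using image[of a] image[of b] unfolding pos_def by (simp add: prefix_split[OF ab])
  moreover have "prefix (pos b) X = prefix (pos a) X @ X [pos a \<rightarrow> pos b]"
    by (rule subsequence_join[symmetric]) (use ab in \<open>auto intro: pos_mono\<close>)
  ultimately show ?thesis by simp
qed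

lemma block: "X [pos a \<rightarrow> pos a + length (\<phi> (Y a))] = \<phi> (Y a)"
  using pos_segment[of a "Suc a"] by (simp add: pos_Suc)

text \<open>If \<open>r\<close> is the full block length, the letter read is the mark that opens the
  next block; hence the appended \<open>[z]\<close>.\<close>

lemma right_segment:
  assumes "r \<le> length (\<phi> (Y a))"
  shows "X [pos a \<rightarrow> pos a + r] = take r (\<phi> (Y a))" "X (pos a + r) = (\<phi> (Y a) @ [z]) ! r"
proof -
  show "X [pos a \<rightarrow> pos a + r] = take r (\<phi> (Y a))"
    using arg_cong[OF block[of a], of "take r"] assms by (simp add: min_absorb1)
  have nth: "X (pos b + t) = \<phi> (Y b) ! t" if "t < length (\<phi> (Y b))" for b t
    using arg_cong[OF block[of b], of "\<lambda>w. w ! t"] that by simp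
  have "X (pos (Suc a)) = z"
    using nth[of 0 "Suc a"] marked[of 0 "Y (Suc a)"] nonempty by simp
  then show "X (pos a + r) = (\<phi> (Y a) @ [z]) ! r"
    using nth[of r a] assms by (cases "r < length (\<phi> (Y a))") (auto simp: nth_append pos_Suc)
qed

lemma letter: "t < length (\<phi> (Y a)) \<Longrightarrow> X (pos a + t) = \<phi> (Y a) ! t"
  using right_segment(2)[of t a] by (simp add: nth_append)

lemma left_segment:
  assumes "0 < a" "s < length (\<phi> (Y (a - 1)))"
  shows "s < pos a" "X [pos a - s \<rightarrow> pos a] = drop (length (\<phi> (Y (a - 1))) - s) (\<phi> (Y (a - 1)))"
    "X (pos a - s - 1) = \<phi> (Y (a - 1)) ! (length (\<phi> (Y (a - 1))) - s - 1)"
proof -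
  obtain b where b: "a = Suc b" using assms(1) gr0_conv_Suc by blast
  show "s < pos a" using assms by (simp add: b pos_Suc)
  show "X [pos a - s \<rightarrow> pos a] = drop (length (\<phi> (Y (a - 1))) - s) (\<phi> (Y (a - 1)))"
    using arg_cong[OF block[of b], of "drop (length (\<phi> (Y b)) - s)"] assms
    by (simp add: b pos_Suc)
  show "X (pos a - s - 1) = \<phi> (Y (a - 1)) ! (length (\<phi> (Y (a - 1))) - s - 1)"
    using letter[of "length (\<phi> (Y b)) - s - 1" b] assms by (simp add: b pos_Suc)
qed

lemma position_cases:
  obtains a t where "m = pos a + t" "t < length (\<phi> (Y a))"
proof (induction m arbitrary: thesis)
  case 0
  show ?case using 0[of 0 0] nonempty by simp
next
  case (Suc m)
  obtain a t where at: "m = pos a + t" "t < length (\<phi> (Y a))" using Suc.IH by blast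
  show ?case
  proof (cases "Suc t < length (\<phi> (Y a))")
    case True
    then show ?thesis using Suc.prems[of a "Suc t"] at by simp
  next
    case False
    then have "Suc t = length (\<phi> (Y a))" using at by simp
    then show ?thesis using Suc.prems[of "Suc a" 0] at nonempty by (simp add: pos_Suc)
  qed
qed

lemma mark_iff: "X m = z \<longleftrightarrow> (\<exists>a. m = pos a)"
proof
  assume z: "X m = z"
  obtain a t where "m = pos a + t" "t < length (\<phi> (Y a))" by (rule position_cases)
  then show "\<exists>a. m = pos a" using z letter marked by auto
next
  show "\<exists>a. m = pos a \<Longrightarrow> X m = z"
    using letter[of 0] marked[of 0] nonempty by auto
qed

text \<open>Two neighbours lie in one block or straddle a boundary; appending \<open>z\<close> to
  the block covers both situations.\<close>

lemma next_letter:
  obtains a t where "t < length (\<phi> a)" "X m = \<phi> a ! t" "X (Suc m) = (\<phi> a @ [z]) ! Suc t"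
  using position_cases[of m] letter right_segment(2) by (metis Suc_leI add_Suc_right)

lemma mark_within:
  assumes "\<And>a. length (\<phi> a) \<le> N"
  obtains k where "k < N" "X (m + k) = z"
proof -
  obtain a t where at: "m = pos a + t" "t < length (\<phi> (Y a))" by (rule position_cases)
  have "X (pos a) = z" "X (pos (Suc a)) = z" using mark_iff by blast+
  moreover have "m + (length (\<phi> (Y a)) - t) = pos (Suc a)" using at by (simp add: pos_Suc)
  ultimately show thesis
    using that[of 0] that[of "length (\<phi> (Y a)) - t"] at assms[of "Y a"] by (cases t) auto
qed

text \<open>The images of the two copies match. The match continues to the right through the longest
  common prefix of the mismatching blocks and to the left through the longest common suffix of the
  blocks before, and stops there. The new mismatching letters are recorded because the next lift
  depends on them.\<close>

lemma lift:
  assumes Y: "maximal_repeat Y i p l"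
  defines "c \<equiv> Y (i + l)" and "d \<equiv> Y (i + p + l)"
    and "c' \<equiv> Y (i - 1)" and "d' \<equiv> Y (i + p - 1)"
  obtains i2 l2 where
    "maximal_repeat X i2 (length (morph \<phi> (Y [i \<rightarrow> i + p]))) l2"
    "i2 \<le> pos i" "pos (i + l) \<le> i2 + l2"
    "i2 = 0 \<longleftrightarrow> i = 0"
    "X [i2 \<rightarrow> i2 + l2] = (if i = 0 then [] else drop (length (\<phi> c') - \<sigma> c' d') (\<phi> c'))
       @ morph \<phi> (Y [i \<rightarrow> i + l]) @ take (\<rho> c d) (\<phi> c)"
    "X (i2 + l2) = (\<phi> c @ [z]) ! \<rho> c d"
    "X (i2 + length (morph \<phi> (Y [i \<rightarrow> i + p])) + l2) = (\<phi> d @ [z]) ! \<rho> c d"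
    "0 < i \<Longrightarrow> X (i2 - 1) = \<phi> c' ! (length (\<phi> c') - \<sigma> c' d' - 1)"
    "0 < i \<Longrightarrow> X (i2 + length (morph \<phi> (Y [i \<rightarrow> i + p])) - 1) = \<phi> d' ! (length (\<phi> d') - \<sigma> c' d' - 1)"
    "\<And>\<alpha>. weight \<alpha> (X [i2 \<rightarrow> i2 + length (morph \<phi> (Y [i \<rightarrow> i + p]))])
        = weight (\<lambda>a. weight \<alpha> (\<phi> a)) (Y [i \<rightarrow> i + p])"
proof -
  let ?p2 = "length (morph \<phi> (Y [i \<rightarrow> i + p]))"
  \<comment> \<open>At position 0 there is no preceding block, hence no extension to the
    left.\<close>
  define s where "s = (if i = 0 then 0 else \<sigma> c' d')"
  define S where "S = (if i = 0 then [] else drop (length (\<phi> c') - \<sigma> c' d') (\<phi> c'))"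
  define m where "m = morph \<phi> (Y [i \<rightarrow> i + l])"
  define l2 where "l2 = s + length m + \<rho> c d"
  note D = maximal_repeatD[OF Y]
  have cd: "c \<noteq> d" using D unfolding c_def d_def by simp
  have cd': "c' \<noteq> d'" if "0 < i" using D that unfolding c'_def d'_def by simp
  have posq: "pos (i + p) = pos i + ?p2" by (rule pos_add) simp
  have m': "m = morph \<phi> (Y [i + p \<rightarrow> i + p + l])"
    using Y unfolding m_def maximal_repeat_def by simp
  have posr: "pos (i + l) = pos i + length m" "pos (i + p + l) = pos (i + p) + length m"
    unfolding m_def by (rule pos_add, simp) (fold m_def, unfold m', rule pos_add, simp)
  have S: "s \<le> pos i" "X [pos i - s \<rightarrow> pos i] = S" "X [pos (i + p) - s \<rightarrow> pos (i + p)] = S" "length S = s"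
  proof -
    have "s \<le> pos i \<and> X [pos i - s \<rightarrow> pos i] = S \<and> X [pos (i + p) - s \<rightarrow> pos (i + p)] = S"
    proof (cases "i = 0")
      case False
      then have "s < length (\<phi> (Y (i - 1)))" "s < length (\<phi> (Y (i + p - 1)))"
        using left_le[OF cd'] unfolding s_def c'_def d'_def by auto
      from left_segment(1,2)[OF _ this(1)] left_segment(1,2)[OF _ this(2)] False
      show ?thesis
        using left_eq[OF cd'] unfolding s_def S_def c'_def d'_def by simp
    qed (simp add: s_def S_def)
    then show "s \<le> pos i" "X [pos i - s \<rightarrow> pos i] = S" "X [pos (i + p) - s \<rightarrow> pos (i + p)] = S"
      by auto
    then show "length S = s"
      using subsequence_length[of X "pos i - s" "pos i"] by simp
  qed
  have seg1: "X [pos i - s \<rightarrow> pos i - s + l2] = S @ m @ take (\<rho> c d) (\<phi> c)"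
  proof -
    have "X [pos (i + l) \<rightarrow> pos (i + l) + \<rho> c d] = take (\<rho> c d) (\<phi> c)"
      using right_segment(1)[of "\<rho> c d" "i + l"] right_le[OF cd] unfolding c_def by simp
    moreover have "X [pos i \<rightarrow> pos (i + l)] = m" unfolding m_def by (rule pos_segment) simp
    moreover have "pos i - s + l2 = pos (i + l) + \<rho> c d"
      using S(1) by (simp add: l2_def posr)
    ultimately show ?thesis
      using S by (metis append_assoc diff_le_self le_add1 posr(1) subsequence_join trans_le_add1)
  qed
  have seg2: "X [pos (i + p) - s \<rightarrow> pos (i + p) - s + l2] = S @ m @ take (\<rho> c d) (\<phi> c)"
  proof -
    have "X [pos (i + p + l) \<rightarrow> pos (i + p + l) + \<rho> c d] = take (\<rho> c d) (\<phi> c)"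
      using right_segment(1)[of "\<rho> c d" "i + p + l"] right_le[OF cd] right_eq[OF cd] unfolding d_def by simp
    moreover have "X [pos (i + p) \<rightarrow> pos (i + p + l)] = m" unfolding m' by (rule pos_segment) simp
    moreover have "pos (i + p) - s + l2 = pos (i + p + l) + \<rho> c d"
      using S(1) by (simp add: l2_def posr posq)
    ultimately show ?thesis
      using S by (metis append_assoc diff_le_self le_add1 posr(2) subsequence_join trans_le_add1)
  qed
  have shift: "pos (i + p) - s = pos i - s + ?p2" using S(1) posq by simp
  have end1: "pos i - s + l2 = pos (i + l) + \<rho> c d"
    and end2: "pos i - s + ?p2 + l2 = pos (i + p + l) + \<rho> c d"
    using S(1) by (simp_all add: l2_def posr posq)
  have R: "X (pos i - s + l2) = (\<phi> c @ [z]) ! \<rho> c d"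
    "X (pos i - s + ?p2 + l2) = (\<phi> d @ [z]) ! \<rho> c d"
    using right_segment(2)[of "\<rho> c d" "i + l"] right_segment(2)[of "\<rho> c d" "i + p + l"]
      right_le[OF cd] unfolding c_def[symmetric] d_def[symmetric] end1[symmetric] end2[symmetric]
    by auto
  have L: "0 < pos i - s" "X (pos i - s - 1) = \<phi> c' ! (length (\<phi> c') - \<sigma> c' d' - 1)"
    "X (pos (i + p) - s - 1) = \<phi> d' ! (length (\<phi> d') - \<sigma> c' d' - 1)" if "0 < i"
    using left_segment[of i s] left_segment[of "i + p" s] left_le[OF cd'] that
    unfolding c'_def d'_def s_def by auto
  note L = L[unfolded shift]
  have p2: "0 < ?p2" using D(1) posq strict_mono_pos[THEN strict_monoD, of i "i + p"] by linarith
  have max: "maximal_repeat X (pos i - s) ?p2 l2"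
    unfolding maximal_repeat_def
    using p2 seg1 seg2[unfolded shift] R right_neq[OF cd] L left_neq[OF cd'] by (cases "i = 0") auto
  have per: "weight \<alpha> (X [pos i - s \<rightarrow> pos i - s + ?p2]) = weight (\<lambda>a. weight \<alpha> (\<phi> a)) (Y [i \<rightarrow> i + p])" for \<alpha>
  proof -
    \<comment> \<open>Moving the window of one period left by \<open>s\<close> drops one copy of
      \<open>S\<close> and adds another, so its weight does not change.\<close>
    have "X [pos i - s \<rightarrow> pos i] @ X [pos i \<rightarrow> pos (i + p)] =
      X [pos i - s \<rightarrow> pos (i + p) - s] @ X [pos (i + p) - s \<rightarrow> pos (i + p)]"
      by (subst (1 2) subsequence_join) (use posq in auto)
    then have "weight \<alpha> (X [pos i - s \<rightarrow> pos i]) + weight \<alpha> (X [pos i \<rightarrow> pos (i + p)]) =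
      weight \<alpha> (X [pos i - s \<rightarrow> pos (i + p) - s]) + weight \<alpha> (X [pos (i + p) - s \<rightarrow> pos (i + p)])"
      by (metis map_append sum_list_append)
    then have "weight \<alpha> (X [pos i \<rightarrow> pos (i + p)]) = weight \<alpha> (X [pos i - s \<rightarrow> pos (i + p) - s])"
      using S(2,3) by simp
    then show ?thesis
      by (simp add: shift pos_segment weight_morph)
  qed
  show thesis
  proof (rule that[OF max])
    show "pos i - s = 0 \<longleftrightarrow> i = 0" using L(1) by (cases "i = 0") auto
    show "pos (i + l) \<le> pos i - s + l2" using S(1) by (simp add: posr l2_def)
  qed (use seg1 R L per in \<open>auto simp: S_def m_def\<close>)
qed

text \<open>The mark at \<open>pos i\<close> recurs \<open>p\<close> positions later, at a boundary
  \<open>pos b\<close>. The blocks from \<open>i\<close> and from \<open>b\<close> on then agree one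
  by one, since two different blocks differ at offset \<open>\<rho>\<close>; so \<open>Y\<close>
  inherits the period \<open>b - i\<close>.\<close>

lemma unlift_infinite:
  assumes "0 < p" and match: "\<And>k. i \<le> k \<Longrightarrow> X k = X (k + p)"
  obtains a p' where "0 < p'" "\<And>k. a \<le> k \<Longrightarrow> Y k = Y (k + p')" "p = length (morph \<phi> (Y [a \<rightarrow> a + p']))"
proof -
  have "X (pos i + p) = z"
    using match[of "pos i"] strict_mono_imp_increasing[OF strict_mono_pos, of i] mark_iff by metis
  then obtain b where b: "pos i + p = pos b" using mark_iff by blast
  then have "i < b" using assms(1) strict_mono_less[OF strict_mono_pos] by (metis less_add_same_cancel1)
  define p' where "p' = b - i"
  have p': "0 < p'" "b = i + p'" using \<open>i < b\<close> by (auto simp: p'_def)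
  have "Y (i + k) = Y (b + k)" for k
  proof (induction k rule: less_induct)
    case (less k)
    then have eq: "Y [i \<rightarrow> i + k] = Y [b \<rightarrow> b + k]" by (simp add: subsequence_eq_iff)
    have "pos (i + k) + p = pos (b + k)"
      using pos_add[of i "i + k"] pos_add[of b "b + k"] eq b by simp
    then have shift: "pos (i + k) + t + p = pos (b + k) + t" for t by simp
    have "X (pos (i + k) + t) = X (pos (b + k) + t)" for t
      using match[of "pos (i + k) + t"] strict_mono_imp_increasing[OF strict_mono_pos, of "i + k"]
      unfolding shift by simp
    then show "Y (i + k) = Y (b + k)"
      using right_segment(2)[of "\<rho> (Y (i + k)) (Y (b + k))" "i + k"]
        right_segment(2)[of "\<rho> (Y (i + k)) (Y (b + k))" "b + k"]
        right_le[of "Y (i + k)" "Y (b + k)"] right_neq[of "Y (i + k)" "Y (b + k)"] by metis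
  qed
  then have "Y k = Y (k + p')" if "i \<le> k" for k
    using that p'(2) by (metis add.assoc add.commute le_Suc_ex)
  moreover have "p = length (morph \<phi> (Y [i \<rightarrow> i + p']))"
    using pos_add[of i b] b p'(2) by simp
  ultimately show thesis using that p'(1) by blast
qed

text \<open>A mark in the repeated part and its copy are block boundaries \<open>pos a\<close> and
  \<open>pos b\<close>, which fixes the period \<open>b - a\<close> in \<open>Y\<close>. The empty
  repeat at \<open>a\<close> is then extended to a maximal one.\<close>

lemma unlift:
  assumes X: "maximal_repeat X i2 p2 l2" and k: "i2 \<le> k" "k < i2 + l2" "X k = z"
  obtains i p l where "maximal_repeat Y i p l" "p2 = length (morph \<phi> (Y [i \<rightarrow> i + p]))"
    "pos i \<le> k" "k \<le> pos (i + l)"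
proof -
  obtain a where a: "k = pos a" using k(3) mark_iff by blast
  have "X (k + p2) = z" using maximal_repeat_match[OF X k(1,2)] k(3) by simp
  then obtain b where b: "k + p2 = pos b" using mark_iff by blast
  then have "a < b"
    using a maximal_repeatD(1)[OF X] strict_mono_less[OF strict_mono_pos, of a b] by simp
  define p where "p = b - a"
  have p: "0 < p" "b = a + p" using \<open>a < b\<close> by (auto simp: p_def)
  \<comment> \<open>Otherwise \<open>X\<close> would have period \<open>p2\<close> from
    \<open>pos a\<close> on, contrary to the mismatch at \<open>i2 + l2\<close>.\<close>
  have "\<exists>t\<ge>a. Y t \<noteq> Y (t + p)"
  proof (rule ccontr)
    assume "\<not> ?thesis"
    then have Yeq: "Y t = Y (t + p)" if "a \<le> t" for t using that by blast
    \<comment> \<open>Every block has at least one letter, so this many blocks reach past the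
      mismatch.\<close>
    define n where "n = Suc (i2 + l2)"
    have "Y [a \<rightarrow> a + n] = Y [b \<rightarrow> b + n]"
      unfolding subsequence_eq_iff
    proof (intro allI impI)
      show "Y (a + k) = Y (b + k)" for k
        using Yeq[of "a + k"] p(2) by (simp add: ac_simps)
    qed
    then have "X [pos a \<rightarrow> pos (a + n)] = X [pos b \<rightarrow> pos (b + n)]"
      and "pos (a + n) - pos a = pos (b + n) - pos b"
      using pos_segment[of a "a + n"] pos_segment[of b "b + n"]
        pos_add[of a "a + n"] pos_add[of b "b + n"] by simp_all
    moreover have "i2 + l2 < pos (a + n)"
      using strict_mono_imp_increasing[OF strict_mono_pos, of "a + n"] by (simp add: n_def)
    ultimately have "X (pos a + (i2 + l2 - pos a)) = X (pos b + (i2 + l2 - pos a))"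
      using a k(2) by (metis diff_less_mono less_imp_le_nat subsequence_nth)
    moreover have "pos a + (i2 + l2 - pos a) = i2 + l2" "pos b + (i2 + l2 - pos a) = i2 + p2 + l2"
      using a k(2) b by simp_all
    ultimately have "X (i2 + l2) = X (i2 + p2 + l2)" by simp
    then show False using maximal_repeatD(3)[OF X] by simp
  qed
  then obtain i l where il: "maximal_repeat Y i p l" "i \<le> a" "a \<le> i + l"
    using ex_maximal_repeat[of p a a Y] p(1) by auto
  \<comment> \<open>The factors from \<open>i\<close> to \<open>a\<close> and from
    \<open>i + p\<close> to \<open>b\<close> coincide, so the distance \<open>p2\<close> between
    \<open>pos a\<close> and \<open>pos b\<close> is also that between \<open>pos i\<close> and
    \<open>pos (i + p)\<close>.\<close>
  have "Y [i \<rightarrow> i + (a - i)] = Y [i + p \<rightarrow> i + p + (a - i)]"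
    unfolding subsequence_eq_iff using maximal_repeatD(2)[OF il(1)] il(2,3) by auto
  then have "pos a - pos i = pos b - pos (i + p)"
    using pos_add[of i a] pos_add[of "i + p" b] il(2) p(2) by (simp add: algebra_simps)
  then have "p2 = pos (i + p) - pos i"
    using a b pos_mono[OF il(2)] pos_mono[of "i + p" b] pos_mono[of i "i + p"] il(2) p(2) by linarith
  then have "p2 = length (morph \<phi> (Y [i \<rightarrow> i + p]))"
    using pos_add[of i "i + p"] by simp
  moreover have "pos i \<le> k" "k \<le> pos (i + l)" using il a pos_mono by auto
  ultimately show thesis using that il(1) by auto
qed

end

text \<open>The primed functions charge a letter of \<open>Y\<close> with the weight of its block,
  and a mismatch with the weight of the extension plus the charge of the new mismatch. This makes
  \<open>cost\<close> and the weight of a period invariant under lifting.\<close>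

locale weighted_marked_image = marked_image +
  fixes \<alpha> :: "'b \<Rightarrow> real" and R L \<alpha>' R' L'
  assumes weight': "\<alpha>' a = weight \<alpha> (\<phi> a)"
    and right': "c \<noteq> d \<Longrightarrow> R' c d = weight \<alpha> (take (\<rho> c d) (\<phi> c))
      + R ((\<phi> c @ [z]) ! \<rho> c d) ((\<phi> d @ [z]) ! \<rho> c d)"
    and left': "c \<noteq> d \<Longrightarrow> L' c d = weight \<alpha> (drop (length (\<phi> c) - \<sigma> c d) (\<phi> c))
      + L (\<phi> c ! (length (\<phi> c) - \<sigma> c d - 1)) (\<phi> d ! (length (\<phi> d) - \<sigma> c d - 1))"
begin

lemma lift_cost:
  assumes Y: "maximal_repeat Y i p l"
  obtains i2 p2 l2 where "maximal_repeat X i2 p2 l2"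
    "p2 = length (morph \<phi> (Y [i \<rightarrow> i + p]))" "i2 \<le> pos i" "pos (i + l) \<le> i2 + l2"
    "cost \<alpha> R L X i2 p2 l2 = cost \<alpha>' R' L' Y i p l"
    "weight \<alpha> (X [i2 \<rightarrow> i2 + p2]) = weight \<alpha>' (Y [i \<rightarrow> i + p])"
proof (rule lift[OF Y], goal_cases)
  case (1 i2 l2)
  note * = 1(2-)
  have \<alpha>': "\<alpha>' = (\<lambda>a. weight \<alpha> (\<phi> a))" using weight' by blast
  note D = maximal_repeatD[OF Y]
  show thesis
  proof (rule that[of i2 "length (morph \<phi> (Y [i \<rightarrow> i + p]))" l2])
    show "maximal_repeat X i2 (length (morph \<phi> (Y [i \<rightarrow> i + p]))) l2" "i2 \<le> pos i" "pos (i + l) \<le> i2 + l2"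
      using * by simp_all
    show "cost \<alpha> R L X i2 (length (morph \<phi> (Y [i \<rightarrow> i + p]))) l2 = cost \<alpha>' R' L' Y i p l"
    proof (cases "i = 0")
      case True
      then show ?thesis
        using *(4,5,6,7) right'[OF D(3)] by (simp add: cost_def \<alpha>' weight_morph)
    next
      case False
      then have "0 < i" by simp
      with False show ?thesis
        unfolding cost_def *(5,6,7) *(8,9)[OF \<open>0 < i\<close>] right'[OF D(3)] left'[OF D(4)[OF \<open>0 < i\<close>]]
        using *(4) by (simp add: weight_morph \<alpha>')
    qed
    show "weight \<alpha> (X [i2 \<rightarrow> i2 + length (morph \<phi> (Y [i \<rightarrow> i + p]))]) = weight \<alpha>' (Y [i \<rightarrow> i + p])"
      unfolding *(10) \<alpha>' ..
  qed simp
qed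

text \<open>The repeat found by \<open>unlift\<close> lifts to one that has period \<open>p2\<close>
  and touches \<open>k\<close>; by uniqueness this is the given one.\<close>

lemma unlift_cost:
  assumes X: "maximal_repeat X i2 p2 l2" and k: "i2 \<le> k" "k < i2 + l2" "X k = z"
  obtains i p l where "maximal_repeat Y i p l"
    "p2 = length (morph \<phi> (Y [i \<rightarrow> i + p]))"
    "cost \<alpha> R L X i2 p2 l2 = cost \<alpha>' R' L' Y i p l"
    "weight \<alpha> (X [i2 \<rightarrow> i2 + p2]) = weight \<alpha>' (Y [i \<rightarrow> i + p])"
proof -
  obtain i p l where *: "maximal_repeat Y i p l" "p2 = length (morph \<phi> (Y [i \<rightarrow> i + p]))"
    "pos i \<le> k" "k \<le> pos (i + l)"
    using unlift[OF assms] by metis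
  obtain i3 l3 where **: "maximal_repeat X i3 p2 l3" "i3 \<le> pos i" "pos (i + l) \<le> i3 + l3"
    "cost \<alpha> R L X i3 p2 l3 = cost \<alpha>' R' L' Y i p l"
    "weight \<alpha> (X [i3 \<rightarrow> i3 + p2]) = weight \<alpha>' (Y [i \<rightarrow> i + p])"
    using lift_cost[OF *(1)] *(2) by metis
  have "i2 = i3" "l2 = l3"
    using maximal_repeat_unique[OF X **(1), of k] * ** k by auto
  then show thesis using that * ** by blast
qed

end

section \<open>Limit words as images under morphisms\<close>

lemma word_tendsto_prefix:
  assumes "word_tendsto W w"
  shows "\<forall>\<^sub>F m in sequentially. n \<le> length (W m) \<and> take n (W m) = prefix n w"
proof -
  have "\<forall>\<^sub>F m in sequentially. \<forall>k\<in>{..<n}. k < length (W m) \<and> W m ! k = w k"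
    using assms unfolding word_tendsto_def by (intro eventually_ball_finite) auto
  then show ?thesis
  proof eventually_elim
    case (elim m)
    then have "n \<le> length (W m)" by (metis lessThan_iff less_irrefl not_le)
    then show ?case using elim by (auto simp: list_eq_iff_nth_eq)
  qed
qed

lemma morph_inf_image:
  assumes "word_tendsto (\<lambda>n. morph \<phi> (prefix n Y)) X"
  shows "prefix (length (morph \<phi> (prefix n Y))) X = morph \<phi> (prefix n Y)"
proof -
  let ?N = "length (morph \<phi> (prefix n Y))"
  obtain m where m: "n \<le> m" "take ?N (morph \<phi> (prefix m Y)) = prefix ?N X"
    using eventually_conj[OF eventually_ge_at_top[of n] word_tendsto_prefix[OF assms, of ?N]]
    by (auto simp: eventually_sequentially)
  have "morph \<phi> (prefix m Y) = morph \<phi> (prefix n Y) @ morph \<phi> (Y [n \<rightarrow> m])"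
    using subsequence_join[of 0 n m Y] m(1) by (metis le0 morph_append)
  then show ?thesis using m(2) by simp
qed

text \<open>The limit is a fixed point: choose \<open>m\<close> such that the \<open>m\<close>-th
  iterate and its image both agree with \<open>w\<close> far enough.\<close>

lemma omega_iterate_image:
  assumes "word_tendsto (\<lambda>n. (morph \<phi> ^^ n) [a]) w"
  shows "prefix (length (morph \<phi> (prefix n w))) w = morph \<phi> (prefix n w)"
proof -
  let ?N = "length (morph \<phi> (prefix n w))"
  obtain m where m: "take n ((morph \<phi> ^^ m) [a]) = prefix n w"
     "take ?N ((morph \<phi> ^^ Suc m) [a]) = prefix ?N w"
  proof -
    have "\<forall>\<^sub>F m in sequentially. take ?N ((morph \<phi> ^^ Suc m) [a]) = prefix ?N w"
      using word_tendsto_prefix[OF assms, of ?N]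
      by (subst eventually_sequentially_Suc) (auto elim: eventually_mono)
    from eventually_conj[OF this word_tendsto_prefix[OF assms, of n]]
    show thesis using that by (auto simp: eventually_sequentially)
  qed
  have "(morph \<phi> ^^ m) [a] = prefix n w @ drop n ((morph \<phi> ^^ m) [a])"
    using m(1) by (metis append_take_drop_id)
  then have "(morph \<phi> ^^ Suc m) [a] = morph \<phi> (prefix n w) @ morph \<phi> (drop n ((morph \<phi> ^^ m) [a]))"
    by (metis comp_apply funpow.simps(2) morph_append)
  then show ?thesis using m(2) by simp
qed

section \<open>The three words\<close>

definition x_word :: "ternary word" where "x_word = omega_iterate morph_h T0"
definition v_word :: "ternary word" where "v_word = morph_inf morph_g x_word"
definition u_word :: "binary word" where "u_word = morph_inf morph_f v_word"

text \<open>The initial values are the lengths of \<open>f(011)\<close> and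
  \<open>f(0110121)\<close>. The values are real because they get halved and compared with multiples
  of \<open>sqrt 2\<close>.\<close>

fun pell :: "nat \<Rightarrow> real" where
  "pell 0 = 5"
| "pell (Suc 0) = 13"
| "pell (Suc (Suc n)) = 2 * pell (Suc n) + pell n"

text \<open>\<open>pell_weight n a\<close> is the length of \<open>f(g(h\<^sup>n(a)))\<close>; similarly, \<open>pell_right n\<close> and
  \<open>pell_left n\<close> are the total extensions under \<open>f \<circ> g \<circ> h\<^sup>n\<close>. For each of \<open>f\<close>, \<open>g\<close>, \<open>h\<close> they
  depend only on whether one of the mismatching letters is \<open>T0\<close>.\<close>

fun pell_weight :: "nat \<Rightarrow> ternary \<Rightarrow> real" where
  "pell_weight n T0 = pell n"
| "pell_weight n T1 = pell (Suc n) - pell n"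
| "pell_weight n T2 = pell (Suc n)"

definition by_T0 :: "'b \<Rightarrow> 'b \<Rightarrow> ternary \<Rightarrow> ternary \<Rightarrow> 'b" where
  "by_T0 r s c d = (if c = T0 \<or> d = T0 then r else s)"

definition pell_right :: "nat \<Rightarrow> ternary \<Rightarrow> ternary \<Rightarrow> real" where
  "pell_right n = by_T0 ((pell (Suc n) - 3) / 2) (pell (Suc n) - (pell n + 3) / 2)"

definition pell_left :: "nat \<Rightarrow> ternary \<Rightarrow> ternary \<Rightarrow> real" where
  "pell_left n = by_T0 ((pell n + 1) / 2) ((pell (Suc n) + 1) / 2)"

fun f_weight :: "ternary \<Rightarrow> real" where
  "f_weight T0 = 1"
| "f_weight T1 = 2"
| "f_weight T2 = 3"

text \<open>On either side, a mismatch involving \<open>T0\<close> lifts to one between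
  \<open>T1\<close> and \<open>T2\<close>, and a mismatch between \<open>T1\<close> and
  \<open>T2\<close> to one involving \<open>T0\<close>. The two cases alternate, and the formulas in
  \<open>pell_right\<close> and \<open>pell_left\<close> solve the resulting recurrences.\<close>

lemma h_image: "weighted_marked_image h_letter x_word x_word T0 (by_T0 1 2) (by_T0 0 1)
  (pell_weight n) (pell_right n) (pell_left n)
  (pell_weight (Suc n)) (pell_right (Suc n)) (pell_left (Suc n))"
proof
  show "prefix (length (morph h_letter (prefix n x_word))) x_word = morph h_letter (prefix n x_word)" for n
    using omega_iterate_image[OF omega_iterate_h[unfolded morph_h_def]]
    unfolding x_word_def morph_h_def .
  show "h_letter a \<noteq> []" for a by (cases a) auto
  show "h_letter a ! k = T0 \<longleftrightarrow> k = 0" if "k < length (h_letter a)" for a k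
    using that by (cases a) (auto simp: less_Suc_eq)
  fix c d :: ternary assume "c \<noteq> d"
  then show "by_T0 1 2 c d \<le> length (h_letter c) \<and> by_T0 1 2 c d \<le> length (h_letter d)"
    and "take (by_T0 1 2 c d) (h_letter c) = take (by_T0 1 2 c d) (h_letter d)"
    and "(h_letter c @ [T0]) ! by_T0 1 2 c d \<noteq> (h_letter d @ [T0]) ! by_T0 1 2 c d"
    and "by_T0 0 1 c d < length (h_letter c) \<and> by_T0 0 1 c d < length (h_letter d)"
    and "drop (length (h_letter c) - by_T0 0 1 c d) (h_letter c) =
         drop (length (h_letter d) - by_T0 0 1 c d) (h_letter d)"
    and "h_letter c ! (length (h_letter c) - by_T0 0 1 c d - 1) \<noteq> h_letter d ! (length (h_letter d) - by_T0 0 1 c d - 1)"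
    and "pell_right (Suc n) c d = weight (pell_weight n) (take (by_T0 1 2 c d) (h_letter c)) +
     pell_right n ((h_letter c @ [T0]) ! by_T0 1 2 c d) ((h_letter d @ [T0]) ! by_T0 1 2 c d)"
    and "pell_left (Suc n) c d = weight (pell_weight n) (drop (length (h_letter c) - by_T0 0 1 c d) (h_letter c)) +
     pell_left n (h_letter c ! (length (h_letter c) - by_T0 0 1 c d - 1)) (h_letter d ! (length (h_letter d) - by_T0 0 1 c d - 1))"
    by (cases c; cases d; simp add: by_T0_def pell_right_def pell_left_def field_simps numeral_2_eq_2)+
next
  show "pell_weight (Suc n) a = weight (pell_weight n) (h_letter a)" for a
    by (cases a) auto
qed

lemma g_image: "weighted_marked_image g_letter x_word v_word T0 (by_T0 2 4) (by_T0 1 3)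
  f_weight (by_T0 1 2) (by_T0 0 1)
  (pell_weight 0) (pell_right 0) (pell_left 0)"
proof
  show "prefix (length (morph g_letter (prefix n x_word))) v_word = morph g_letter (prefix n x_word)" for n
    using morph_inf_image[OF morph_g_inf[unfolded morph_g_def]]
    unfolding v_word_def morph_g_def .
  show "g_letter a \<noteq> []" for a by (cases a) auto
  show "g_letter a ! k = T0 \<longleftrightarrow> k = 0" if "k < length (g_letter a)" for a k
    using that by (cases a) (auto simp: less_Suc_eq)
  fix c d :: ternary assume "c \<noteq> d"
  then show "by_T0 2 4 c d \<le> length (g_letter c) \<and> by_T0 2 4 c d \<le> length (g_letter d)"
    and "take (by_T0 2 4 c d) (g_letter c) = take (by_T0 2 4 c d) (g_letter d)"
    and "(g_letter c @ [T0]) ! by_T0 2 4 c d \<noteq> (g_letter d @ [T0]) ! by_T0 2 4 c d"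
    and "by_T0 1 3 c d < length (g_letter c) \<and> by_T0 1 3 c d < length (g_letter d)"
    and "drop (length (g_letter c) - by_T0 1 3 c d) (g_letter c) =
         drop (length (g_letter d) - by_T0 1 3 c d) (g_letter d)"
    and "g_letter c ! (length (g_letter c) - by_T0 1 3 c d - 1) \<noteq> g_letter d ! (length (g_letter d) - by_T0 1 3 c d - 1)"
    and "pell_right 0 c d = weight f_weight (take (by_T0 2 4 c d) (g_letter c)) +
     by_T0 1 2 ((g_letter c @ [T0]) ! by_T0 2 4 c d) ((g_letter d @ [T0]) ! by_T0 2 4 c d)"
    and "pell_left 0 c d = weight f_weight (drop (length (g_letter c) - by_T0 1 3 c d) (g_letter c)) +
     by_T0 0 1 (g_letter c ! (length (g_letter c) - by_T0 1 3 c d - 1)) (g_letter d ! (length (g_letter d) - by_T0 1 3 c d - 1))"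
    by (cases c; cases d; simp add: by_T0_def pell_right_def pell_left_def eval_nat_numeral)+
next
  show "pell_weight 0 a = weight f_weight (g_letter a)" for a
    by (cases a) auto
qed

text \<open>Unit weights and zero extensions make the cost of a repeat in \<open>u_word\<close>
  equal to \<open>l\<close> itself.\<close>

lemma f_image: "weighted_marked_image f_letter v_word u_word B0 (by_T0 1 2) (by_T0 0 1)
  (\<lambda>_. 1) (\<lambda>_ _. 0) (\<lambda>_ _. 0) f_weight (by_T0 1 2) (by_T0 0 1)"
proof
  show "prefix (length (morph f_letter (prefix n v_word))) u_word = morph f_letter (prefix n v_word)" for n
    using morph_inf_image[OF morph_f_inf[unfolded morph_f_def]]
    unfolding u_word_def morph_f_def .
  show "f_letter a \<noteq> []" for a by (cases a) auto
  show "f_letter a ! k = B0 \<longleftrightarrow> k = 0" if "k < length (f_letter a)" for a k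
    using that by (cases a) (auto simp: less_Suc_eq)
  fix c d :: ternary assume "c \<noteq> d"
  then show "by_T0 1 2 c d \<le> length (f_letter c) \<and> by_T0 1 2 c d \<le> length (f_letter d)"
    and "take (by_T0 1 2 c d) (f_letter c) = take (by_T0 1 2 c d) (f_letter d)"
    and "(f_letter c @ [B0]) ! by_T0 1 2 c d \<noteq> (f_letter d @ [B0]) ! by_T0 1 2 c d"
    and "by_T0 0 1 c d < length (f_letter c) \<and> by_T0 0 1 c d < length (f_letter d)"
    and "drop (length (f_letter c) - by_T0 0 1 c d) (f_letter c) =
         drop (length (f_letter d) - by_T0 0 1 c d) (f_letter d)"
    and "f_letter c ! (length (f_letter c) - by_T0 0 1 c d - 1) \<noteq> f_letter d ! (length (f_letter d) - by_T0 0 1 c d - 1)"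
    and "by_T0 1 2 c d = weight (\<lambda>_. 1) (take (by_T0 1 2 c d) (f_letter c)) + 0"
    and "by_T0 0 1 c d = weight (\<lambda>_. 1) (drop (length (f_letter c) - by_T0 0 1 c d) (f_letter c)) + 0"
    by (cases c; cases d; simp add: by_T0_def eval_nat_numeral)+
next
  show "f_weight a = weight (\<lambda>_. 1) (f_letter a)" for a
    by (cases a) auto
qed

interpretation h: weighted_marked_image h_letter x_word x_word T0 "by_T0 1 2" "by_T0 0 1"
  "pell_weight n" "pell_right n" "pell_left n" "pell_weight (Suc n)" "pell_right (Suc n)" "pell_left (Suc n)" for n
  by (rule h_image)

interpretation g: weighted_marked_image g_letter x_word v_word T0 "by_T0 2 4" "by_T0 1 3"
  f_weight "by_T0 1 2" "by_T0 0 1" "pell_weight 0" "pell_right 0" "pell_left 0"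
  by (rule g_image)

interpretation f: weighted_marked_image f_letter v_word u_word B0 "by_T0 1 2" "by_T0 0 1"
  "\<lambda>_. 1" "\<lambda>_ _. 0" "\<lambda>_ _. 0" f_weight "by_T0 1 2" "by_T0 0 1"
  by (rule f_image)

section \<open>Aperiodicity\<close>

lemma length_h: "length (morph h_letter w) \<ge> 2 * length w"
proof (induction w)
  case (Cons a w)
  then show ?case by (cases a) auto
qed simp

text \<open>Infinite descent: an eventual period is the length of the image under \<open>h\<close>
  of a factor whose length is again an eventual period, and \<open>h\<close> at least doubles
  lengths.\<close>

lemma x_not_eventually_periodic:
  assumes "0 < p"
  shows "\<exists>k\<ge>i. x_word k \<noteq> x_word (k + p)"
  using assms
proof (induction p arbitrary: i rule: less_induct)
  case (less p)
  show ?case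
  proof (rule ccontr)
    assume "\<not> ?case"
    then obtain a p' where p': "0 < p'" "\<And>k. a \<le> k \<Longrightarrow> x_word k = x_word (k + p')"
      "p = length (morph h_letter (x_word [a \<rightarrow> a + p']))"
      using h.unlift_infinite[OF less.prems, of i] by blast
    then have "p' < p" using length_h[of "x_word [a \<rightarrow> a + p']"] by simp
    then show False using less.IH[of p' a] p'(1,2) by blast
  qed
qed

lemma u_not_eventually_periodic:
  assumes "0 < p"
  shows "\<exists>k\<ge>i. u_word k \<noteq> u_word (k + p)"
  using f.unlift_infinite[OF assms, of i] g.unlift_infinite x_not_eventually_periodic by metis

section \<open>The upper bound\<close>

lemma sqrt2_bounds: "707 / 500 \<le> sqrt 2" "sqrt 2 \<le> (283 / 200 :: real)"
  by (rule real_le_rsqrt, simp add: power2_eq_square) (rule real_le_lsqrt, simp_all add: power2_eq_square)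

lemma pell_ge: "5 \<le> pell n" "2 * pell n \<le> pell (Suc n)"
proof (induction n)
  case (Suc n)
  { case 1 show ?case using Suc by simp }
  { case 2 show ?case using Suc by simp }
qed auto

text \<open>Each step multiplies the deviation by \<open>1 - sqrt 2\<close>, the second root of
  \<open>t^2 = 2 t + 1\<close>, whose modulus is below 1.\<close>

lemma pell_ratio: "\<bar>pell (Suc n) - (1 + sqrt 2) * pell n\<bar> \<le> 1"
proof (induction n)
  case 0
  show ?case using sqrt2_bounds by (simp add: abs_le_iff field_simps)
next
  case (Suc n)
  have "pell (Suc (Suc n)) - (1 + sqrt 2) * pell (Suc n) = (1 - sqrt 2) * (pell (Suc n) - (1 + sqrt 2) * pell n)"
    by (simp add: algebra_simps)
  moreover have "\<bar>(1 - sqrt 2) * (pell (Suc n) - (1 + sqrt 2) * pell n)\<bar> \<le> 1 * 1"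
    unfolding abs_mult using Suc sqrt2_bounds by (intro mult_mono) auto
  ultimately show ?case by simp
qed

text \<open>The bound for \<open>l / p\<close>; the claimed critical exponent is
  \<open>1 + K\<close>.\<close>

abbreviation "K \<equiv> 1 + sqrt 2 / 2"

lemma weight_split:
  "a \<le> b \<Longrightarrow> b \<le> c \<Longrightarrow> weight \<alpha> (w [a \<rightarrow> c]) = weight \<alpha> (w [a \<rightarrow> b]) + weight \<alpha> (w [b \<rightarrow> c])"
  by (metis map_append subsequence_join sum_list_append)

lemma weight_mono:
  assumes "\<And>a. 0 \<le> \<alpha> a" "b \<le> c"
  shows "weight \<alpha> (w [a \<rightarrow> b]) \<le> weight \<alpha> (w [a \<rightarrow> c])"
proof -
  have nonneg: "0 \<le> weight \<alpha> v" for v by (induction v) (simp_all add: assms(1))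
  show ?thesis
  proof (cases "a \<le> b")
    case True
    show ?thesis unfolding weight_split[OF True assms(2)] using nonneg by simp
  next
    case False
    then have "w [a \<rightarrow> b] = []" by simp
    then show ?thesis using nonneg by simp
  qed
qed

lemma segment_simps:
  "w [a \<rightarrow> a] = []"
  "w [a \<rightarrow> a + 1] = [w a]"
  "w [a \<rightarrow> a + 2] = [w a, w (a + 1)]"
  "w [a \<rightarrow> a + 3] = [w a, w (a + 1), w (a + 2)]"
  by (simp_all add: subsequence_def upt_rec numeral_2_eq_2 numeral_3_eq_3)

text \<open>For \<open>p \<le> l\<close>, each position behind the repeated part is \<open>p\<close>
  after one inside it, so the mark is absent from the whole repetition.\<close>

lemma repeat_nonmark:
  assumes "maximal_repeat w i p l" "\<And>k. i \<le> k \<Longrightarrow> k < i + l \<Longrightarrow> w k \<noteq> z"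
    and "p \<le> l" "i \<le> k" "k < i + p + l"
  shows "w k \<noteq> z"
proof (cases "k < i + l")
  case False
  then have "i \<le> k - p" "k - p < i + l" "k - p + p = k" using assms(3-5) by auto
  then show ?thesis using maximal_repeat_match[OF assms(1), of "k - p"] assms(2)[of "k - p"] by simp
qed (use assms in blast)

lemma by_T0_le: "r \<le> s \<Longrightarrow> by_T0 r s c d \<le> (s :: real)"
  by (simp add: by_T0_def)

section \<open>Repeats in \<open>x_word\<close>\<close>

lemma x_next: "x_word m = T0 \<Longrightarrow> x_word (Suc m) \<noteq> T0" "x_word m = T1 \<Longrightarrow> x_word (Suc m) = T0"
  "x_word (Suc m) = T1 \<Longrightarrow> x_word m = T0" "x_word (Suc m) = T2 \<Longrightarrow> x_word m \<noteq> T1"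
proof -
  obtain a t where at: "t < length (h_letter a)" "x_word m = h_letter a ! t"
    "x_word (Suc m) = (h_letter a @ [T0]) ! Suc t"
    by (rule h.next_letter)
  show "x_word m = T0 \<Longrightarrow> x_word (Suc m) \<noteq> T0" "x_word m = T1 \<Longrightarrow> x_word (Suc m) = T0"
  "x_word (Suc m) = T1 \<Longrightarrow> x_word m = T0" "x_word (Suc m) = T2 \<Longrightarrow> x_word m \<noteq> T1"
    using at by (cases a; auto simp: less_Suc_eq)+
qed

lemma x_gap: "x_word m = T0 \<or> x_word (m + 1) = T0 \<or> x_word (m + 2) = T0"
proof -
  have "length (h_letter a) \<le> 3" for a by (cases a) auto
  then obtain k where "k < 3" "x_word (m + k) = T0" by (rule h.mark_within)
  then show ?thesis by (auto simp: less_Suc_eq numeral_3_eq_3 numeral_2_eq_2)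
qed

lemma pell_weight_ge: "0 \<le> pell_weight n a" "pell n \<le> pell_weight n a" "a \<noteq> T0 \<Longrightarrow> pell (Suc n) - pell n \<le> pell_weight n a"
  using pell_ge[of n] by (cases a; simp)+

lemma pell_cost_le:
  "pell_right n c d \<le> pell (Suc n) - (pell n + 3) / 2" "pell_left n c d \<le> (pell (Suc n) + 1) / 2"
proof -
  show "pell_right n c d \<le> pell (Suc n) - (pell n + 3) / 2"
    unfolding pell_right_def by (rule by_T0_le) (use pell_ge[of n] in \<open>simp add: field_simps\<close>)
  show "pell_left n c d \<le> (pell (Suc n) + 1) / 2"
    unfolding pell_left_def by (rule by_T0_le) (use pell_ge[of n] in \<open>simp add: field_simps\<close>)
qed

text \<open>By \<open>x_gap\<close>, a repeated part without \<open>T0\<close> has at most two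
  letters, which leaves few cases. All \<open>n\<close> are treated at once since \<open>n\<close>
  counts the descents through \<open>h\<close> made so far. Asymptotically no slack remains for the
  repetition 22 and for a single \<open>T0\<close> with nothing repeated.\<close>

lemma x_base:
  assumes rep: "maximal_repeat x_word i p l"
    and no: "\<And>k. i \<le> k \<Longrightarrow> k < i + l \<Longrightarrow> x_word k \<noteq> T0"
  shows "cost (pell_weight n) (pell_right n) (pell_left n) x_word i p l
    \<le> K * weight (pell_weight n) (x_word [i \<rightarrow> i + p])"
proof -
  define a b where "a = pell n" and "b = pell (Suc n)"
  define P where "P = weight (pell_weight n) (x_word [i \<rightarrow> i + p])"
  define W where "W = weight (pell_weight n) (x_word [i \<rightarrow> i + l])"
  define C where "C = cost (pell_weight n) (pell_right n) (pell_left n) x_word i p l"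
  define s where "s = sqrt 2"
  note D = maximal_repeatD[OF rep]
  have s: "707 / 500 \<le> s" "s \<le> 283 / 200" using sqrt2_bounds by (auto simp: s_def)
  have ab: "5 \<le> a" "2 * a \<le> b" using pell_ge[of n] by (auto simp: a_def b_def)
  have ratio: "b - a - s * a \<le> 1" "a + s * a - b \<le> 1"
    using pell_ratio[of n] by (auto simp: a_def b_def s_def algebra_simps abs_le_iff)
  have sa: "707 / 500 * a \<le> s * a" "707 / 500 * b \<le> s * b" "s * a \<le> 283 / 200 * a" using s ab by simp_all
  \<comment> \<open>Both extensions are bounded by their larger values, those for mismatches between
    \<open>T1\<close> and \<open>T2\<close>.\<close>
  have C_le: "C \<le> W + (3 * b - a) / 2 - 1"
  proof -
    have "C \<le> W + (b - (a + 3) / 2) + (b + 1) / 2"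
      unfolding C_def cost_def W_def a_def b_def
      by (intro add_mono pell_cost_le order_refl) (use pell_cost_le(2)[of n] pell_ge[of n] in auto)
    then show ?thesis by (simp add: field_simps)
  qed
  \<comment> \<open>When both mismatches involve \<open>T0\<close>, both extensions take their
    smaller values.\<close>
  have C_T0: "C \<le> W + (a + b) / 2 - 1"
    if "x_word (i + l) = T0 \<or> x_word (i + p + l) = T0"
      "0 < i \<Longrightarrow> x_word (i - 1) = T0 \<or> x_word (i + p - 1) = T0"
    using that ab by (simp add: C_def cost_def W_def[symmetric] pell_right_def pell_left_def by_T0_def
        a_def[symmetric] b_def[symmetric] field_simps)
  have P_ge: "weight (pell_weight n) (x_word [i \<rightarrow> j]) \<le> P" if "j \<le> i + p" for j
    unfolding P_def by (rule weight_mono) (use that pell_weight_ge in auto)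
  have KP: "K * P = P + s * P / 2" by (simp add: s_def algebra_simps)
  have KP_le: "Q + s * Q / 2 \<le> K * P" if "Q \<le> P" for Q
    unfolding KP using that s by (intro add_mono divide_right_mono mult_left_mono) auto
  have C_short: "C \<le> K * P" if "W = 0" "b \<le> P"
  proof -
    have "C \<le> 3 / 2 * b" using C_le that ab by (simp add: field_simps)
    then show ?thesis using KP_le[OF that(2)] sa(2) ab by linarith
  qed
  \<comment> \<open>Two neighbours weigh at least \<open>b\<close>: \<open>T2\<close> alone does,
    and \<open>T0\<close> and \<open>T1\<close> together have weight exactly
    \<open>b\<close>.\<close>
  have P2: "b \<le> P" if "2 \<le> p"
    using P_ge[of "i + 2"] that pell_weight_ge[where n = n] x_next(1)[of i] unfolding segment_simps
    by (cases "x_word i") (auto simp: a_def b_def, smt+)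
  have "C \<le> K * P"
  proof (cases "p \<le> l")
    case True
    have nz: "x_word k \<noteq> T0" if "i \<le> k" "k < i + p + l" for k
      using repeat_nonmark[OF rep no True] that by blast
    \<comment> \<open>The whole repetition avoids \<open>T0\<close>, so \<open>p + l \<le> 2\<close>
      by \<open>x_gap\<close>.\<close>
    have "p = 1" "l = 1"
      using x_gap[of i] nz[of i] nz[of "i + 1"] nz[of "i + 2"] D(1) True by linarith+
    have eq: "x_word i = x_word (i + 1)" using D(2)[of 0] \<open>p = 1\<close> \<open>l = 1\<close> by simp
    have two: "x_word i = T2"
      using x_next(2)[of i] nz[of i] nz[of "i + 1"] eq \<open>p = 1\<close> \<open>l = 1\<close> by (cases "x_word i") auto
    have W: "W = b" "P = b" unfolding W_def P_def \<open>p = 1\<close> \<open>l = 1\<close> segment_simps by (simp_all add: two b_def)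
    have "x_word (i + 2) = T0" using x_gap[of i] eq two by simp
    moreover have "x_word (i - 1) = T0" if "0 < i"
      using D(4)[OF that] x_next(4)[of "i - 1"] two that \<open>p = 1\<close> by (cases "x_word (i - 1)") auto
    ultimately have "C \<le> b + (a + b) / 2 - 1"
      using C_T0 W \<open>p = 1\<close> \<open>l = 1\<close> by (simp add: numeral_2_eq_2)
    \<comment> \<open>The bound amounts to \<open>a + b - 2 \<le> s * b\<close> here. This comes
      from the lower ratio bound multiplied by \<open>s - 1\<close>, the inverse of
      \<open>1 + s\<close>.\<close>
    moreover have "a - 2 \<le> s * b - b"
    proof -
      have "(s - 1) * (a + s * a - 1) \<le> (s - 1) * b"
        using ratio s by (intro mult_left_mono) auto
      moreover have "s * s = 2" by (simp add: s_def)
      then have "(s - 1) * (a + s * a - 1) = a - s + 1" by (simp add: algebra_simps)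
      moreover have "(s - 1) * b = s * b - b" by (simp add: algebra_simps)
      ultimately show ?thesis using s by linarith
    qed
    ultimately show ?thesis unfolding KP unfolding W by (simp add: field_simps)
  next
    case False
    then have "l < p" by simp
    consider "l = 0" "p = 1" | "l = 0" "2 \<le> p" | "l = 1" | "l = 2" | "3 \<le> l" using D(1) by linarith
    then show ?thesis
    proof cases
      case 1
      have W: "W = 0" "P = pell_weight n (x_word i)" unfolding W_def P_def 1 segment_simps by simp_all
      show ?thesis
      proof (cases "x_word i = T2")
        case True
        then show ?thesis using W by (intro C_short) (simp_all add: b_def)
      next
        case False
        \<comment> \<open>The letter is \<open>T0\<close> itself or a \<open>T1\<close>, whose
          neighbours are \<open>T0\<close>; so both mismatches involve \<open>T0\<close>.\<close>
        have "x_word (i + l) = T0 \<or> x_word (i + p + l) = T0"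
          using x_next(2)[of i] False 1 by (cases "x_word i") auto
        moreover have "x_word (i - 1) = T0 \<or> x_word (i + p - 1) = T0" if "0 < i"
          using x_next(3)[of "i - 1"] False 1 that by (cases "x_word i") auto
        ultimately have "C \<le> (a + b) / 2 - 1" using C_T0 W by simp
        moreover have "a + s * a / 2 \<le> K * P"
          using W pell_weight_ge(2)[of n "x_word i"] pell_weight_ge(3)[of "x_word i" n] by (intro KP_le) (simp add: a_def)
        ultimately show ?thesis using ratio by (simp add: field_simps)
      qed
    next
      case 2
      have "W = 0" unfolding W_def 2 segment_simps by simp
      then show ?thesis using P2[OF 2(2)] by (rule C_short)
    next
      case 3
      then have "2 \<le> p" using \<open>l < p\<close> by simp
      have "x_word i \<noteq> T0" using no[of i] 3 by simp
      moreover have "x_word i \<noteq> T1"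
      proof
        assume "x_word i = T1"
        then show False using x_next(2)[of i] x_next(2)[of "i + p"] D(2)[of 0] D(3) 3 by simp
      qed
      ultimately have i: "x_word i = T2" by (cases "x_word i") auto
      have W: "W = b" unfolding W_def 3 segment_simps by (simp add: i b_def)
      have "b + a \<le> P"
        using P_ge[of "i + 2"] \<open>2 \<le> p\<close> pell_weight_ge(2)[of n "x_word (Suc i)"]
        unfolding segment_simps by (simp add: i a_def b_def)
      from KP_le[OF this] have "b + a + (s * b / 2 + s * a / 2) \<le> K * P"
        by (simp add: distrib_left add_divide_distrib)
      moreover have "C \<le> 5 / 2 * b - a / 2 - 1" using C_le W by (simp add: field_simps)
      ultimately show ?thesis using sa ab ratio by linarith
    next
      case 4
      then have "3 \<le> p" using \<open>l < p\<close> by simp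
      have "x_word i \<noteq> T0" "x_word (Suc i) \<noteq> T0" using no[of i] no[of "Suc i"] 4 by simp_all
      then have i: "x_word i = T2" "x_word (Suc i) = T2"
        using x_next(2,3)[of i] by (cases "x_word i"; cases "x_word (Suc i)"; auto)+
      have W: "W = 2 * b" unfolding W_def 4 segment_simps by (simp add: i b_def)
      have "2 * b + a \<le> P"
        using P_ge[of "i + 3"] \<open>3 \<le> p\<close> pell_weight_ge(2)[of n "x_word (i + 2)"]
        unfolding segment_simps by (simp add: i a_def b_def)
      from KP_le[OF this] have "2 * b + a + (s * b + s * a / 2) \<le> K * P"
        by (simp add: distrib_left add_divide_distrib)
      moreover have "C \<le> 7 / 2 * b - a / 2 - 1" using C_le W by (simp add: field_simps)
      ultimately show ?thesis using sa ab ratio by linarith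
    next
      case 5
      then show ?thesis using x_gap[of i] no[of i] no[of "i + 1"] no[of "i + 2"] by auto
    qed
  qed
  then show ?thesis by (simp add: C_def P_def)
qed

text \<open>A repeat whose repeated part contains \<open>T0\<close> comes via \<open>h\<close> from
  one with a shorter period, with \<open>n\<close> raised by one and cost and weight unchanged; for
  the others there is \<open>x_base\<close>.\<close>

lemma x_bound:
  assumes "maximal_repeat x_word i p l"
  shows "cost (pell_weight n) (pell_right n) (pell_left n) x_word i p l
    \<le> K * weight (pell_weight n) (x_word [i \<rightarrow> i + p])"
  using assms
proof (induction p arbitrary: n i l rule: less_induct)
  case (less p)
  show ?case
  proof (cases "\<exists>k. i \<le> k \<and> k < i + l \<and> x_word k = T0")
    case False
    then show ?thesis by (intro x_base less.prems) auto
  next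
    case True
    then obtain k where k: "i \<le> k" "k < i + l" "x_word k = T0" by blast
    obtain i' p' l' where *: "maximal_repeat x_word i' p' l'"
      "p = length (morph h_letter (x_word [i' \<rightarrow> i' + p']))"
      "cost (pell_weight n) (pell_right n) (pell_left n) x_word i p l =
       cost (pell_weight (Suc n)) (pell_right (Suc n)) (pell_left (Suc n)) x_word i' p' l'"
      "weight (pell_weight n) (x_word [i \<rightarrow> i + p]) = weight (pell_weight (Suc n)) (x_word [i' \<rightarrow> i' + p'])"
      by (rule h.unlift_cost[OF less.prems k, of n])
    then have "p' < p"
      using length_h[of "x_word [i' \<rightarrow> i' + p']"] maximal_repeatD(1)[OF *(1)] by simp
    then show ?thesis unfolding *(3,4) using less.IH *(1) by blast
  qed
qed

section \<open>Repeats in \<open>v_word\<close>\<close>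

lemma v_gap: obtains k where "k < 6" "v_word (m + k) = T0"
proof -
  have "length (g_letter a) \<le> 6" for a by (cases a) auto
  then show thesis using that by (rule g.mark_within)
qed

text \<open>Among the blocks 011, 0121 and 012121, each followed by 0, only the first has equal
  neighbours.\<close>

lemma v_square:
  assumes "v_word m = v_word (Suc m)"
  shows "v_word m = T1" "v_word (m + 2) = T0" "0 < m" "v_word (m - 1) = T0"
proof -
  obtain a t where at: "m = g.pos a + t" "t < length (g_letter (x_word a))" by (rule g.position_cases)
  have m: "v_word m = (g_letter (x_word a) @ [T0]) ! t" "v_word (Suc m) = (g_letter (x_word a) @ [T0]) ! Suc t"
    using g.right_segment(2)[of t a] g.right_segment(2)[of "Suc t" a] at by auto
  have t: "t = 1 \<and> x_word a = T0"
    using at(2) m assms by (cases "x_word a") (auto simp: less_Suc_eq)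
  then show "v_word m = T1" "0 < m" using m at(1) by auto
  show "v_word (m + 2) = T0" using g.right_segment(2)[of 3 a] at(1) t by (simp add: numeral_3_eq_3)
  show "v_word (m - 1) = T0" using g.right_segment(2)[of 0 a] at(1) t by simp
qed

text \<open>Five consecutive letters other than \<open>T0\<close> fit only into the block 012121,
  where they are everything after the mark.\<close>

lemma v_five:
  assumes "\<And>k. k < 5 \<Longrightarrow> v_word (m + k) \<noteq> T0"
  shows "v_word m = T1" "v_word (m + 1) = T2" "v_word (m + 5) = T0" "v_word (m - 1) = T0"
proof -
  obtain a t where at: "m = g.pos a + t" "t < length (g_letter (x_word a))" by (rule g.position_cases)
  have letters: "v_word (g.pos a + r) = (g_letter (x_word a) @ [T0]) ! r" if "r \<le> length (g_letter (x_word a))" for r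
    using g.right_segment(2)[OF that] .
  have "v_word (g.pos a) = T0" using g.mark_iff by blast
  then have "t \<noteq> 0" using assms[of 0] at(1) by (intro notI) simp
  moreover have "\<not> length (g_letter (x_word a)) < t + 5"
  proof
    assume "length (g_letter (x_word a)) < t + 5"
    then have "length (g_letter (x_word a)) - t < 5" using at(2) by linarith
    from assms[OF this] show False
      using letters[of "length (g_letter (x_word a))"] at by simp
  qed
  ultimately have t: "t = 1 \<and> x_word a = T2"
    using at(2) by (cases "x_word a") auto
  then show "v_word m = T1" "v_word (m + 1) = T2" "v_word (m + 5) = T0" "v_word (m - 1) = T0"
    using letters[of 1] letters[of 2] letters[of 6] letters[of 0] at(1) by (auto simp: numeral_2_eq_2 add.commute)
qed

lemma f_weight_ge: "1 \<le> f_weight a" "a \<noteq> T0 \<Longrightarrow> 2 \<le> f_weight a"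
  by (cases a; simp)+

text \<open>Under \<open>f\<close> the extensions add up to at most 3, and to at most 1 if both
  mismatches involve \<open>T0\<close>. A rational lower bound for \<open>K\<close> is enough in
  each case.\<close>

lemma v_base:
  assumes rep: "maximal_repeat v_word i p l"
    and no: "\<And>k. i \<le> k \<Longrightarrow> k < i + l \<Longrightarrow> v_word k \<noteq> T0"
  shows "cost f_weight (by_T0 1 2) (by_T0 0 1) v_word i p l
    \<le> K * weight f_weight (v_word [i \<rightarrow> i + p])"
proof -
  define P where "P = weight f_weight (v_word [i \<rightarrow> i + p])"
  define W where "W = weight f_weight (v_word [i \<rightarrow> i + l])"
  define C where "C = cost f_weight (by_T0 1 2) (by_T0 0 1) v_word i p l"
  note D = maximal_repeatD[OF rep]
  have C_le: "C \<le> W + 3"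
    by (simp add: C_def cost_def W_def[symmetric] by_T0_def)
  have C_T0: "C \<le> W + 1"
    if "v_word (i + l) = T0 \<or> v_word (i + p + l) = T0"
      "0 < i \<Longrightarrow> v_word (i - 1) = T0 \<or> v_word (i + p - 1) = T0"
    using that by (simp add: C_def cost_def W_def[symmetric] by_T0_def)
  \<comment> \<open>The constant is \<open>1 + (707 / 500) / 2\<close>.\<close>
  have KP: "1707 / 1000 * Q \<le> K * P" if "Q \<le> P" "0 \<le> Q" for Q
    using that sqrt2_bounds by (intro mult_mono) auto
  have mono: "weight f_weight (v_word [i \<rightarrow> j]) \<le> weight f_weight (v_word [i \<rightarrow> j'])" if "j \<le> j'" for j j'
    by (rule weight_mono) (use that f_weight_ge(1) in \<open>auto intro: order_trans[of 0 1]\<close>)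
  have "C \<le> K * P"
  proof (cases "p \<le> l")
    case True
    have nz: "v_word k \<noteq> T0" if "i \<le> k" "k < i + p + l" for k
      using repeat_nonmark[OF rep no True] that by blast
    obtain k where k: "k < 6" "v_word (i + k) = T0" by (rule v_gap)
    then have "p + l \<le> 5" using nz[of "i + k"] by linarith
    have not_square: "v_word k \<noteq> v_word (Suc k)" if "i \<le> k" "k + 2 < i + p + l" for k
      using v_square(2)[of k] nz[of "k + 2"] that by auto
    \<comment> \<open>This would be an equal pair followed by a letter other than
      \<open>T0\<close>.\<close>
    have "\<not> (p = 1 \<and> 2 \<le> l)" using not_square[of i] D(2)[of 0] by auto
    then consider "p = 1" "l = 1" | "p = 2" "l = 2" | "p = 2" "l = 3"
      using D(1) True \<open>p + l \<le> 5\<close> by linarith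
    then show ?thesis
    proof cases
      case 1
      then have "v_word i = v_word (Suc i)" using D(2)[of 0] by simp
      note sq = v_square[OF this]
      have "C \<le> W + 1" using C_T0 sq 1 by (simp add: numeral_2_eq_2)
      moreover have "W = 2" "P = 2" unfolding W_def P_def 1 segment_simps by (simp_all add: sq(1))
      ultimately show ?thesis using KP[of 2] by simp
    next
      case 2
      have "5 \<le> P"
        unfolding P_def 2 segment_simps using nz[of i] nz[of "Suc i"] not_square[of i] 2
        by (cases "v_word i"; cases "v_word (Suc i)") auto
      moreover have "W = P" by (simp add: W_def P_def 2)
      ultimately show ?thesis using C_le KP[of P] by linarith
    next
      case 3
      \<comment> \<open>The repetition is the factor 12121 of the block 012121, with
        \<open>T0\<close> on both sides.\<close>
      have nz5: "v_word (i + k) \<noteq> T0" if "k < 5" for k using nz[of "i + k"] 3 that by simp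
      note five = v_five[OF nz5]
      have "W = 7" "P = 5"
        unfolding W_def P_def 3 segment_simps using five(1,2) D(2)[of 0] D(2)[of 1] 3
        by (simp_all add: numeral_2_eq_2)
      have "C \<le> W + 1" using C_T0 five 3 by (simp add: add.commute)
      then show ?thesis using \<open>W = 7\<close> \<open>P = 5\<close> KP[of 5] by simp
    qed
  next
    case False
    show ?thesis
    proof (cases "l = 0")
      case True
      have W: "W = 0" unfolding W_def True segment_simps by simp
      show ?thesis
      proof (cases "p = 1 \<and> v_word i = T0")
        case T: True
        have "C \<le> W + 1" by (rule C_T0) (use T True in auto)
        moreover have "P = 1" unfolding P_def using T segment_simps(2)[of v_word i] by simp
        ultimately show ?thesis using W KP[of 1] by simp
      next
        case F: False
        have "2 \<le> P"
        proof (cases "p = 1")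
          case True
          then show ?thesis unfolding P_def True segment_simps using F True f_weight_ge(2)[of "v_word i"] by simp
        next
          case False
          then have "i + 2 \<le> i + p" using D(1) by simp
          from mono[OF this] show ?thesis
            unfolding P_def segment_simps using f_weight_ge(1)[of "v_word i"] f_weight_ge(1)[of "v_word (i + 1)"] by simp
        qed
        then show ?thesis using C_le W KP[of 2] by simp
      qed
    next
      case l: False
      have "v_word i \<noteq> T0" using no[of i] l by simp
      moreover have "weight f_weight (v_word [i \<rightarrow> i + 1]) \<le> W"
        unfolding W_def by (rule mono) (use l in simp)
      ultimately have "2 \<le> W" unfolding segment_simps using f_weight_ge(2)[of "v_word i"] by simp
      \<comment> \<open>The period is longer than the repeated part by at least one letter. With
        \<open>2 \<le> W\<close> this gives
        \<open>W + 3 \<le> 1707 / 1000 * (W + 1)\<close>.\<close>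
      moreover have "W + 1 \<le> P"
      proof -
        have "weight f_weight (v_word [i \<rightarrow> i + l + 1]) \<le> P"
          unfolding P_def by (rule mono) (use False in simp)
        then show ?thesis
          using weight_split[of i "i + l" "i + l + 1" f_weight v_word] f_weight_ge(1)[of "v_word (i + l)"]
          unfolding W_def by simp
      qed
      ultimately show ?thesis using C_le KP[of "W + 1"] by simp
    qed
  qed
  then show ?thesis by (simp add: C_def P_def)
qed

lemma v_bound:
  assumes "maximal_repeat v_word i p l"
  shows "cost f_weight (by_T0 1 2) (by_T0 0 1) v_word i p l
    \<le> K * weight f_weight (v_word [i \<rightarrow> i + p])"
proof (cases "\<exists>k. i \<le> k \<and> k < i + l \<and> v_word k = T0")
  case False
  then show ?thesis by (intro v_base assms) auto
next
  case True
  then obtain k where k: "i \<le> k" "k < i + l" "v_word k = T0" by blast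
  show ?thesis
    using g.unlift_cost[OF assms k] x_bound by metis
qed

section \<open>Repeats and powers in \<open>u_word\<close>\<close>

lemma weight_1: "weight (\<lambda>_. 1) w = real (length w)"
  by (induction w) auto

text \<open>If the repeated part contains no \<open>B0\<close>, then \<open>l \<le> p\<close>:
  otherwise the whole repetition would be free of \<open>B0\<close> and have at least three letters,
  while any three consecutive letters contain a \<open>B0\<close>.\<close>

lemma u_bound:
  assumes rep: "maximal_repeat u_word i p l"
  shows "real l \<le> K * real p"
proof (cases "\<exists>k. i \<le> k \<and> k < i + l \<and> u_word k = B0")
  case True
  then obtain k where k: "i \<le> k" "k < i + l" "u_word k = B0" by blast
  have "cost (\<lambda>_. 1) (\<lambda>_ _. 0) (\<lambda>_ _. 0) u_word i p l \<le> K * weight (\<lambda>_. 1) (u_word [i \<rightarrow> i + p])"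
    using f.unlift_cost[OF rep k] v_bound by metis
  then show ?thesis by (simp add: cost_def weight_1)
next
  case False
  have "length (f_letter a) \<le> 3" for a by (cases a) auto
  then obtain k where k: "k < 3" "u_word (i + k) = B0" by (rule f.mark_within)
  have "l \<le> p"
  proof (rule ccontr)
    assume "\<not> l \<le> p"
    moreover have "\<not> k < p + l"
      using repeat_nonmark[OF rep, of B0 "i + k"] False k \<open>\<not> l \<le> p\<close> by auto
    ultimately show False using k(1) maximal_repeatD(1)[OF rep] by linarith
  qed
  then have "1 * real l \<le> K * real p" by (intro mult_mono) auto
  then show ?thesis by simp
qed

text \<open>A factor longer than its period \<open>p\<close> extends to a maximal repeat of period
  \<open>p\<close>, because \<open>u_word\<close> is not eventually periodic; shorter factors have
  exponent at most 1.\<close>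

lemma contains_power_u_le:
  assumes "contains_power u_word \<alpha>"
  shows "real_of_rat \<alpha> \<le> 2 + sqrt 2 / 2"
proof -
  obtain z p where z: "factor z u_word" "has_period z p" "\<alpha> \<le> of_nat (length z) / of_nat p"
    using assms unfolding contains_power_def has_exponent_def by blast
  obtain i j where ij: "z = u_word [i \<rightarrow> j]" using z(1) unfolding factor_def by blast
  have "0 < p" using z(2) unfolding has_period_def by blast
  have "real (length z) \<le> (2 + sqrt 2 / 2) * p"
  proof (cases "length z \<le> p")
    case True
    have "1 * real (length z) \<le> (2 + sqrt 2 / 2) * p"
      using True by (intro mult_mono) auto
    then show ?thesis by simp
  next
    case False
    then have len: "p < j - i" using ij by simp
    have "u_word k = u_word (k + p)" if "i \<le> k" "k < j - p" for k
      using z(2) that unfolding has_period_def ij by (auto dest!: spec[of _ "k - i"])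
    then obtain i' l where *: "maximal_repeat u_word i' p l" "i' \<le> i" "j - p \<le> i' + l"
      using ex_maximal_repeat[OF \<open>0 < p\<close>, of i "j - p" u_word] u_not_eventually_periodic[OF \<open>0 < p\<close>] len
      by (metis add.commute less_diff_conv less_imp_le_nat)
    then have "length z \<le> l + p" using ij len by simp
    then show ?thesis using u_bound[OF *(1)] by (simp add: algebra_simps)
  qed
  then have "real (length z) / p \<le> 2 + sqrt 2 / 2" using \<open>0 < p\<close> by (simp add: field_simps)
  moreover have "real_of_rat \<alpha> \<le> real_of_rat (of_nat (length z) / of_nat p)"
    using z(3) by (simp add: of_rat_less_eq)
  ultimately show ?thesis by (simp add: of_rat_divide)
qed

section \<open>The lower bound\<close>

text \<open>Each lift through \<open>h\<close> lowers the index of the weights and extensions by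
  one.\<close>

lemma lift_iterated:
  assumes "maximal_repeat x_word i p l"
  obtains i' p' l' where "maximal_repeat x_word i' p' l'"
    "cost (pell_weight 0) (pell_right 0) (pell_left 0) x_word i' p' l' =
     cost (pell_weight n) (pell_right n) (pell_left n) x_word i p l"
    "weight (pell_weight 0) (x_word [i' \<rightarrow> i' + p']) = weight (pell_weight n) (x_word [i \<rightarrow> i + p])"
  using assms
proof (induction n arbitrary: i p l thesis)
  case (Suc n)
  show ?case
    using h.lift_cost[OF Suc.prems(2), of n] Suc.IH Suc.prems(1) by metis
qed blast

text \<open>These are the lifts of the single \<open>T0\<close> at position 2 of the word 0102...,
  regarded as an empty repeat of period 1. The \<open>T0\<close> at position 0 would give shorter
  repeats, as nothing extends to the left there.\<close>

lemma ex_repeat_u: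
  obtains i p l where "maximal_repeat u_word i p l" "real p = pell n" "real l = (pell n + pell (Suc n)) / 2 - 1"
proof -
  have "x_word 0 = T0" using h.mark_iff[of 0] h.pos_0 by metis
  then have "x_word 0 = T0" "x_word 1 = T1" using h.letter[of 0 0] h.letter[of 1 0] by simp_all
  then have "prefix 2 x_word = [T0, T1]" by (simp add: subsequence_def upt_rec)
  then have "x_word (Suc 0) = T1 \<and> x_word (Suc (Suc 0)) = T0 \<and> x_word (Suc (Suc (Suc 0))) = T2"
    using h.image[of 2] by simp
  then have x: "x_word 1 = T1" "x_word 2 = T0" "x_word 3 = T2"
    by (simp_all add: numeral_2_eq_2 numeral_3_eq_3)
  \<comment> \<open>The mismatches are 0 against 2 on the right and 1 against 0 on the left; both
    involve \<open>T0\<close>.\<close>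
  then have "maximal_repeat x_word 2 1 0" by (simp add: maximal_repeat_def subsequence_def)
  then obtain i p l where 1: "maximal_repeat x_word i p l"
    "cost (pell_weight 0) (pell_right 0) (pell_left 0) x_word i p l =
     cost (pell_weight n) (pell_right n) (pell_left n) x_word 2 1 0"
    "weight (pell_weight 0) (x_word [i \<rightarrow> i + p]) = weight (pell_weight n) (x_word [2 \<rightarrow> 2 + 1])"
    by (rule lift_iterated)
  obtain i p l where 2: "maximal_repeat v_word i p l"
    "cost f_weight (by_T0 1 2) (by_T0 0 1) v_word i p l =
     cost (pell_weight n) (pell_right n) (pell_left n) x_word 2 1 0"
    "weight f_weight (v_word [i \<rightarrow> i + p]) = weight (pell_weight n) (x_word [2 \<rightarrow> 2 + 1])"
    using g.lift_cost[OF 1(1)] 1(2,3) by metis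
  obtain i p l where 3: "maximal_repeat u_word i p l"
    "cost (\<lambda>_. 1) (\<lambda>_ _. 0) (\<lambda>_ _. 0) u_word i p l =
     cost (pell_weight n) (pell_right n) (pell_left n) x_word 2 1 0"
    "weight (\<lambda>_. 1) (u_word [i \<rightarrow> i + p]) = weight (pell_weight n) (x_word [2 \<rightarrow> 2 + 1])"
    using f.lift_cost[OF 2(1)] 2(2,3) by metis
  have "real p = pell n"
    using 3(3) x unfolding segment_simps weight_1 by simp
  moreover have "real l = (pell n + pell (Suc n)) / 2 - 1"
    using 3(2) x[simplified numeral_2_eq_2 numeral_3_eq_3] by (simp add: cost_def weight_1 segment_simps pell_right_def pell_left_def by_T0_def field_simps)
  ultimately show thesis using that 3(1) by blast
qed

lemma contains_power_repeat:
  assumes "maximal_repeat w i p l"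
  shows "contains_power w (of_nat (p + l) / of_nat p)"
proof -
  let ?z = "w [i \<rightarrow> i + (p + l)]"
  have "has_period ?z p"
    unfolding has_period_def
  proof (intro conjI allI impI)
    fix j assume "j + p < length ?z"
    then show "?z ! j = ?z ! (j + p)"
      using maximal_repeatD(2)[OF assms, of j] by (simp add: ac_simps)
  qed (rule maximal_repeatD(1)[OF assms])
  then have "has_exponent ?z (of_nat (p + l) / of_nat p)"
    unfolding has_exponent_def by (intro exI[of _ p]) simp
  then show ?thesis
    unfolding contains_power_def factor_def using maximal_repeatD(1)[OF assms]
    by (intro exI[of _ ?z] exI[of _ "of_nat (p + l) / of_nat p"]) auto
qed

lemma pell_ge_nat: "real n \<le> pell n"
proof (induction n)
  case (Suc n)
  then show ?case using pell_ge[of n] by simp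
qed simp

theorem theorem17:
  shows "critical_exponent (morph_inf morph_f (morph_inf morph_g (omega_iterate morph_h T0)))
    = ereal (2 + sqrt 2 / 2)"
proof -
  let ?S = "{ereal (of_rat \<alpha>) | \<alpha>. contains_power u_word \<alpha>}"
  \<comment> \<open>The exponents \<open>1 + l / p\<close> of the repeats from
    \<open>ex_repeat_u\<close>.\<close>
  define e where "e n = 1 + ((pell n + pell (Suc n)) / 2 - 1) / pell n" for n
  have "Sup ?S = ereal (2 + sqrt 2 / 2)"
  proof (rule antisym)
    show "Sup ?S \<le> ereal (2 + sqrt 2 / 2)"
      by (rule Sup_least) (use contains_power_u_le in auto)
    have "ereal (e n) \<in> ?S" for n
    proof -
      obtain i p l where *: "maximal_repeat u_word i p l" "real p = pell n"
        "real l = (pell n + pell (Suc n)) / 2 - 1"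
        by (rule ex_repeat_u)
      have "e n = real_of_rat (of_nat (p + l) / of_nat p)"
      proof -
        have "e n = 1 + real l / real p" unfolding e_def *(2,3) ..
        then show ?thesis
          using maximal_repeatD(1)[OF *(1)] by (simp add: of_rat_divide of_rat_add add_divide_distrib)
      qed
      then show ?thesis using contains_power_repeat[OF *(1)] by blast
    qed
    then have le: "ereal (e n) \<le> Sup ?S" for n by (rule Sup_upper)
    have "(\<lambda>n. e n - (2 + sqrt 2 / 2)) \<longlonglongrightarrow> 0"
    proof (rule tendsto_rabs_zero_cancel, rule tendsto_sandwich)
      show "\<forall>\<^sub>F n in sequentially. 0 \<le> \<bar>e n - (2 + sqrt 2 / 2)\<bar>" by simp
      show "\<forall>\<^sub>F n in sequentially. \<bar>e n - (2 + sqrt 2 / 2)\<bar> \<le> 2 / real n"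
        using eventually_gt_at_top[of 0]
      proof eventually_elim
        case (elim n)
        \<comment> \<open>The numerator is bounded by \<open>pell_ratio\<close>, while the
          denominator is at least \<open>n\<close>.\<close>
        have "e n - (2 + sqrt 2 / 2) = ((pell (Suc n) - (1 + sqrt 2) * pell n) / 2 - 1) / pell n"
          using pell_ge(1)[of n] by (simp add: e_def field_simps)
        moreover have "\<bar>(pell (Suc n) - (1 + sqrt 2) * pell n) / 2 - 1\<bar> \<le> 2"
          using pell_ratio[of n] by (simp add: abs_le_iff field_simps)
        ultimately show ?case
          using pell_ge_nat[of n] pell_ge(1)[of n] elim by (simp add: abs_divide frac_le)
      qed
      show "(\<lambda>n. 2 / real n) \<longlonglongrightarrow> 0" by (rule lim_const_over_n)
    qed simp
    then have "e \<longlonglongrightarrow> 2 + sqrt 2 / 2" by (rule LIM_zero_cancel)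
    then have "(\<lambda>n. ereal (e n)) \<longlonglongrightarrow> ereal (2 + sqrt 2 / 2)" by simp
    then show "ereal (2 + sqrt 2 / 2) \<le> Sup ?S"
      by (rule LIMSEQ_le_const2) (use le in blast)
  qed
  then show ?thesis
    unfolding critical_exponent_def u_word_def v_word_def x_word_def .
qed

end
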